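(* Suppose $\beta\ge1+C_F^2$. Let $f\in L^2(\Omega)$, $g\in H^1(\Omega)$ with $g|_\Gamma\le0$, and let $\boldsymbol{u}=(u,\boldsymbol{\sigma},\lambda)\in K^0$ denote the solution of $$b_\beta(\boldsymbol{u},\boldsymbol{v}-\boldsymbol{u})\ge G_\beta(\boldsymbol{v}-\boldsymbol{u})\quad\text{for all }\boldsymbol{v}\in K^0 .$$ Let $K_h\subset U$ be a non-empty convex and closed subset and let $\boldsymbol{u}_h=(u_h,\boldsymbol{\sigma}_h,\lambda_h)\in K_h$ denote the solution of $$b_\beta(\boldsymbol{u}_h,\boldsymbol{v}_h-\boldsymbol{u}_h)\ge G_\beta(\boldsymbol{v}_h-\boldsymbol{u}_h)\quad\text{for all }\boldsymbol{v}_h\in K_h .$$ Then, with a constant $C_{\mathrm{opt}}>0$ depending only on $\beta$ and $\Omega$, $$\|\boldsymbol{u}-\boldsymbol{u}_h\|_U^2\le C_{\mathrm{opt}}\Big(\inf_{\boldsymbol{v}_h\in K_h}\big(\|\boldsymbol{u}-\boldsymbol{v}_h\|_U^2+|\langle\lambda,v_h-u\rangle|\big)+\inf_{\boldsymbol{v}\in K^0}|\langle\lambda,v-u_h\rangle|\Big),$$ where $\boldsymbol{v}_h=(v_h,\boldsymbol{\tau}_h,\mu_h)$ and $\boldsymbol{v}=(v,\boldsymbol{\tau},\mu)$.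
   Context: $\Omega\subset\mathbb{R}^n$, $n\in\{2,3\}$, is a polygonal (polyhedral) bounded Lipschitz domain with boundary $\Gamma$. $(\cdot,\cdot)$ and $\|\cdot\|$ are the $L^2(\Omega)$ (or $L^2(\Omega)^n$) inner product and norm. $H^{-1}(\Omega)$ is the dual of $H_0^1(\Omega)$, with duality $\langle\cdot,\cdot\rangle$ extending the $L^2(\Omega)$ inner product. The generalized divergence $\operatorname{div}:L^2(\Omega)^n\to H^{-1}(\Omega)$ is $\langle\operatorname{div}\boldsymbol{\sigma},v\rangle:=-(\boldsymbol{\sigma},\nabla v)$ for $v\in H_0^1(\Omega)$. $C_F=C_F(\Omega)$, $0<C_F\le\operatorname{diam}(\Omega)$, is the constant in Friedrichs' inequality $\|v\|\le C_F\|\nabla v\|$ for all $v\in H_0^1(\Omega)$. For $v\in H^1(\Omega)$, $v\ge0$ means $v\ge 0$ a.e. in $\Omega$. $U:=\{(u,\boldsymbol{\sigma},\lambda)\in H_0^1(\Omega)\times L^2(\Omega)^n\times H^{-1}(\Omega): \operatorname{div}\boldsymbol{\sigma}+\lambda\in L^2(\Omega)\}$ with norm $\|(u,\boldsymbol{\sigma},\lambda)\|_U^2:=\|\nabla u\|^2+\|\boldsymbol{\sigma}\|^2+\|\operatorname{div}\boldsymbol{\sigma}+\lambda\|^2$. $K^0:=\{(u,\boldsymbol{\sigma},\lambda)\in U: u-g\ge0\}$. For $\boldsymbol{u}=(u,\boldsymbol{\sigma},\lambda)$, $\boldsymbol{v}=(v,\boldsymbol{\tau},\mu)\in U$: $b_\beta(\boldsymbol{u},\boldsymbol{v}):=\beta(\operatorname{div}\boldsymbol{\sigma}+\lambda,\operatorname{div}\boldsymbol{\tau}+\mu)+(\nabla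 u-\boldsymbol{\sigma},\nabla v-\boldsymbol{\tau})+\langle\lambda,v\rangle$, $G_\beta(\boldsymbol{v}):=-\beta(f,\operatorname{div}\boldsymbol{\tau}+\mu)$. Both variational inequalities are uniquely solvable. The solution $\boldsymbol{u}$ of the first one is $(u,\nabla u,-\Delta u-f)$, where $u\in H_0^1(\Omega)$, $u\ge g$, is the solution of the classical obstacle problem $(\nabla u,\nabla(v-u))\ge(f,v-u)$ for all $v\in H_0^1(\Omega)$, $v\ge g$. *)

theory Defs
  imports "HOL-Analysis.Analysis" "HOL-Library.Function_Algebras"
begin

text \<open>
  Pointwise scalar multiplication, so that triples of functions and functionals form a real
  vector space and the library's subtraction and convexity apply to them.
\<close>

instantiation "fun" :: (type, real_vector) real_vector
begin

definition scaleR_fun :: "real \<Rightarrow> ('a \<Rightarrow> 'b) \<Rightarrow> 'a \<Rightarrow> 'b"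
  where "scaleR_fun r f = (\<lambda>x. r *\<^sub>R f x)"

instance
  by standard (auto simp: scaleR_fun_def fun_eq_iff algebra_simps)

end


section \<open>Polyhedral Lipschitz domains\<close>

text \<open>
  Near each boundary point the domain is the strict epigraph, in some unit direction \<open>e\<close>, of a
  Lipschitz function on the hyperplane orthogonal to \<open>e\<close>.
\<close>

definition lipschitz_boundary :: "'a::euclidean_space set \<Rightarrow> bool" where
  "lipschitz_boundary \<Omega> \<longleftrightarrow>
     (\<forall>x\<in>frontier \<Omega>. \<exists>r>0. \<exists>e L. \<exists>\<gamma>::'a \<Rightarrow> real.
        norm e = 1 \<and> L-lipschitz_on {z. z \<bullet> e = 0} \<gamma> \<and>
        \<Omega> \<inter> ball x r = {y \<in> ball x r. \<gamma> (y - (y \<bullet> e) *\<^sub>R e) < y \<bullet> e})"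

definition polyhedral_lipschitz_domain :: "'a::euclidean_space set \<Rightarrow> bool" where
  "polyhedral_lipschitz_domain \<Omega> \<longleftrightarrow>
     open \<Omega> \<and> connected \<Omega> \<and> \<Omega> \<noteq> {} \<and> bounded \<Omega> \<and> lipschitz_boundary \<Omega> \<and>
     (\<exists>\<T>. finite \<T> \<and> (\<forall>T\<in>\<T>. polytope T) \<and> closure \<Omega> = \<Union>\<T>)"


section \<open>Lebesgue and Sobolev spaces\<close>

text \<open>
  Elements of \<open>L\<^sup>2\<close> are represented by functions, of which only the values up to null sets in
  \<open>\<Omega>\<close> matter.  With values in \<open>real\<close> this is \<open>L\<^sup>2(\<Omega>)\<close>, with values in the ambient space it is
  \<open>L\<^sup>2(\<Omega>)\<^sup>n\<close>.
\<close>

definition L2 :: "'a::euclidean_space set \<Rightarrow> ('a \<Rightarrow> 'b::euclidean_space) set" where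
  "L2 \<Omega> = {f \<in> borel_measurable (lebesgue_on \<Omega>). integrable (lebesgue_on \<Omega>) (\<lambda>x. (norm (f x))\<^sup>2)}"

definition L2_inner ::
    "'a::euclidean_space set \<Rightarrow> ('a \<Rightarrow> 'b::euclidean_space) \<Rightarrow> ('a \<Rightarrow> 'b) \<Rightarrow> real" where
  "L2_inner \<Omega> f g = (LINT x|lebesgue_on \<Omega>. f x \<bullet> g x)"

definition L2_norm :: "'a::euclidean_space set \<Rightarrow> ('a \<Rightarrow> 'b::euclidean_space) \<Rightarrow> real" where
  "L2_norm \<Omega> f = sqrt (L2_inner \<Omega> f f)"

primrec Ck :: "nat \<Rightarrow> ('a::euclidean_space \<Rightarrow> real) \<Rightarrow> bool" where
  "Ck 0 f \<longleftrightarrow> continuous_on UNIV f"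
| "Ck (Suc k) f \<longleftrightarrow> (\<forall>x. f differentiable (at x)) \<and>
      (\<forall>i\<in>Basis. Ck k (\<lambda>x. frechet_derivative f (at x) i))"

definition smooth :: "('a::euclidean_space \<Rightarrow> real) \<Rightarrow> bool" where
  "smooth f \<longleftrightarrow> (\<forall>k. Ck k f)"

definition test_functions :: "'a::euclidean_space set \<Rightarrow> ('a \<Rightarrow> real) set" where
  "test_functions \<Omega> =
     {\<phi>. smooth \<phi> \<and> compact (closure {x. \<phi> x \<noteq> 0}) \<and> closure {x. \<phi> x \<noteq> 0} \<subseteq> \<Omega>}"

definition has_weak_gradient ::
    "'a::euclidean_space set \<Rightarrow> ('a \<Rightarrow> real) \<Rightarrow> ('a \<Rightarrow> 'a) \<Rightarrow> bool" where
  "has_weak_gradient \<Omega> u G \<longleftrightarrow> G \<in> L2 \<Omega> \<and>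
     (\<forall>\<phi>\<in>test_functions \<Omega>. \<forall>i\<in>Basis.
        (LINT x|lebesgue_on \<Omega>. u x * frechet_derivative \<phi> (at x) i)
          = - (LINT x|lebesgue_on \<Omega>. (G x \<bullet> i) * \<phi> x))"

definition H1 :: "'a::euclidean_space set \<Rightarrow> ('a \<Rightarrow> real) set" where
  "H1 \<Omega> = {u \<in> L2 \<Omega>. \<exists>G. has_weak_gradient \<Omega> u G}"

text \<open>The weak gradient is unique only up to null sets; a representative is chosen.\<close>

definition wgrad :: "'a::euclidean_space set \<Rightarrow> ('a \<Rightarrow> real) \<Rightarrow> 'a \<Rightarrow> 'a" where
  "wgrad \<Omega> u = (SOME G. has_weak_gradient \<Omega> u G)"

definition H1_norm :: "'a::euclidean_space set \<Rightarrow> ('a \<Rightarrow> real) \<Rightarrow> real" where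
  "H1_norm \<Omega> u = sqrt ((L2_norm \<Omega> u)\<^sup>2 + (L2_norm \<Omega> (wgrad \<Omega> u))\<^sup>2)"

definition H10 :: "'a::euclidean_space set \<Rightarrow> ('a \<Rightarrow> real) set" where
  "H10 \<Omega> = {v \<in> H1 \<Omega>. \<exists>\<phi>::nat \<Rightarrow> 'a \<Rightarrow> real. (\<forall>k. \<phi> k \<in> test_functions \<Omega>) \<and>
     (\<lambda>k. H1_norm \<Omega> (\<phi> k - v)) \<longlonglongrightarrow> 0}"

text \<open>
  The dual of \<open>H10 \<Omega>\<close>; the duality pairing of \<open>l\<close> and \<open>v\<close> is \<open>l v\<close>.  Values of \<open>l\<close> outside
  \<open>H10 \<Omega>\<close> are irrelevant.  A function \<open>w\<close> in \<open>L2 \<Omega>\<close> acts as \<open>L2_inner \<Omega> w\<close>.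
\<close>

definition Hm1 :: "'a::euclidean_space set \<Rightarrow> (('a \<Rightarrow> real) \<Rightarrow> real) set" where
  "Hm1 \<Omega> = {l.
     (\<forall>v\<in>H10 \<Omega>. \<forall>w\<in>H10 \<Omega>. l (v + w) = l v + l w) \<and>
     (\<forall>c. \<forall>v\<in>H10 \<Omega>. l (c *\<^sub>R v) = c * l v) \<and>
     (\<exists>C. \<forall>v\<in>H10 \<Omega>. \<bar>l v\<bar> \<le> C * H1_norm \<Omega> v)}"

definition gdiv :: "'a::euclidean_space set \<Rightarrow> ('a \<Rightarrow> 'a) \<Rightarrow> ('a \<Rightarrow> real) \<Rightarrow> real" where
  "gdiv \<Omega> \<sigma> v = - L2_inner \<Omega> \<sigma> (wgrad \<Omega> v)"

definition friedrichs_constant :: "'a::euclidean_space set \<Rightarrow> real \<Rightarrow> bool" where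
  "friedrichs_constant \<Omega> C \<longleftrightarrow> 0 < C \<and> C \<le> diameter \<Omega> \<and>
     (\<forall>v\<in>H10 \<Omega>. L2_norm \<Omega> v \<le> C * L2_norm \<Omega> (wgrad \<Omega> v))"


section \<open>Boundary traces\<close>

text \<open>
  The \<open>d\<close>-dimensional Hausdorff outer measure, normalised to agree with surface measure on
  \<open>d\<close>-dimensional surfaces.  All Borel sets are Caratheodory measurable for it, so
  \<open>hausdorff_measure\<close> is its restriction to the Borel sets.  The case \<open>d = 0\<close> is not used.
\<close>

definition hausdorff_outer :: "nat \<Rightarrow> 'a::euclidean_space set \<Rightarrow> ennreal" where
  "hausdorff_outer d A =
     (SUP \<delta>\<in>{0<..}. INF C\<in>{C::nat \<Rightarrow> 'a set. A \<subseteq> \<Union>(range C) \<and>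
                            (\<forall>i. bounded (C i) \<and> diameter (C i) \<le> \<delta>)}.
        \<Sum>i. ennreal (unit_ball_vol (real d) * (diameter (C i) / 2) ^ d))"

definition hausdorff_measure :: "nat \<Rightarrow> 'a::euclidean_space measure" where
  "hausdorff_measure d = measure_of UNIV (sets borel) (hausdorff_outer d)"

definition surface_measure :: "'a::euclidean_space set \<Rightarrow> 'a measure" where
  "surface_measure \<Omega> = restrict_space (hausdorff_measure (DIM('a) - 1)) (frontier \<Omega>)"

text \<open>
  The trace operator is the continuous extension to \<open>H1 \<Omega>\<close>, with values in \<open>L\<^sup>2\<close> of the boundary,
  of the restriction of functions smooth up to the boundary.
\<close>

definition has_trace :: "'a::euclidean_space set \<Rightarrow> ('a \<Rightarrow> real) \<Rightarrow> ('a \<Rightarrow> real) \<Rightarrow> bool" where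
  "has_trace \<Omega> g t \<longleftrightarrow> t \<in> borel_measurable (surface_measure \<Omega>) \<and>
     (\<exists>\<phi>::nat \<Rightarrow> 'a \<Rightarrow> real. (\<forall>k. smooth (\<phi> k)) \<and>
        (\<lambda>k. H1_norm \<Omega> (\<phi> k - g)) \<longlonglongrightarrow> 0 \<and>
        (\<lambda>k. \<integral>\<^sup>+x. ennreal ((\<phi> k x - t x)\<^sup>2) \<partial>surface_measure \<Omega>) \<longlonglongrightarrow> 0)"

definition trace_nonpos :: "'a::euclidean_space set \<Rightarrow> ('a \<Rightarrow> real) \<Rightarrow> bool" where
  "trace_nonpos \<Omega> g \<longleftrightarrow> (\<exists>t. has_trace \<Omega> g t \<and> (AE x in surface_measure \<Omega>. t x \<le> 0))"


section \<open>The first-order formulation\<close>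

type_synonym 'a triple = "('a \<Rightarrow> real) \<times> ('a \<Rightarrow> 'a) \<times> (('a \<Rightarrow> real) \<Rightarrow> real)"

definition represents_div_plus ::
    "'a::euclidean_space set \<Rightarrow> ('a \<Rightarrow> 'a) \<Rightarrow> (('a \<Rightarrow> real) \<Rightarrow> real) \<Rightarrow> ('a \<Rightarrow> real) \<Rightarrow> bool" where
  "represents_div_plus \<Omega> \<sigma> l w \<longleftrightarrow>
     w \<in> L2 \<Omega> \<and> (\<forall>v\<in>H10 \<Omega>. gdiv \<Omega> \<sigma> v + l v = L2_inner \<Omega> w v)"

text \<open>The \<open>L\<^sup>2\<close> function \<open>div \<sigma> + l\<close>, unique up to null sets.\<close>

definition div_plus ::
    "'a::euclidean_space set \<Rightarrow> ('a \<Rightarrow> 'a) \<Rightarrow> (('a \<Rightarrow> real) \<Rightarrow> real) \<Rightarrow> 'a \<Rightarrow> real" where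
  "div_plus \<Omega> \<sigma> l = (SOME w. represents_div_plus \<Omega> \<sigma> l w)"

definition U :: "'a::euclidean_space set \<Rightarrow> 'a triple set" where
  "U \<Omega> = {(u, \<sigma>, l). u \<in> H10 \<Omega> \<and> \<sigma> \<in> L2 \<Omega> \<and> l \<in> Hm1 \<Omega> \<and> (\<exists>w. represents_div_plus \<Omega> \<sigma> l w)}"

definition U_norm :: "'a::euclidean_space set \<Rightarrow> 'a triple \<Rightarrow> real" where
  "U_norm \<Omega> = (\<lambda>(u, \<sigma>, l).
     sqrt ((L2_norm \<Omega> (wgrad \<Omega> u))\<^sup>2 + (L2_norm \<Omega> \<sigma>)\<^sup>2 + (L2_norm \<Omega> (div_plus \<Omega> \<sigma> l))\<^sup>2))"

text \<open>
  Closedness with respect to \<open>U_norm\<close>.  A closed set contains with each triple all triples at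
  distance zero, i.e. all other representatives of the same element.
\<close>

definition U_closed :: "'a::euclidean_space set \<Rightarrow> 'a triple set \<Rightarrow> bool" where
  "U_closed \<Omega> K \<longleftrightarrow>
     (\<forall>s w. (\<forall>k::nat. s k \<in> K) \<longrightarrow> w \<in> U \<Omega> \<longrightarrow> (\<lambda>k. U_norm \<Omega> (s k - w)) \<longlonglongrightarrow> 0 \<longrightarrow> w \<in> K)"

definition K0 :: "'a::euclidean_space set \<Rightarrow> ('a \<Rightarrow> real) \<Rightarrow> 'a triple set" where
  "K0 \<Omega> g = {(u, \<sigma>, l). (u, \<sigma>, l) \<in> U \<Omega> \<and> (AE x in lebesgue_on \<Omega>. 0 \<le> u x - g x)}"

definition b_form ::
    "'a::euclidean_space set \<Rightarrow> real \<Rightarrow> 'a triple \<Rightarrow> 'a triple \<Rightarrow> real" where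
  "b_form \<Omega> \<beta> = (\<lambda>(u, \<sigma>, l) (v, \<tau>, m).
     \<beta> * L2_inner \<Omega> (div_plus \<Omega> \<sigma> l) (div_plus \<Omega> \<tau> m)
     + L2_inner \<Omega> (wgrad \<Omega> u - \<sigma>) (wgrad \<Omega> v - \<tau>) + l v)"

definition G_form ::
    "'a::euclidean_space set \<Rightarrow> real \<Rightarrow> ('a \<Rightarrow> real) \<Rightarrow> 'a triple \<Rightarrow> real" where
  "G_form \<Omega> \<beta> f = (\<lambda>(v, \<tau>, m). - \<beta> * L2_inner \<Omega> f (div_plus \<Omega> \<tau> m))"

definition solves_VI ::
    "'a::euclidean_space set \<Rightarrow> real \<Rightarrow> ('a \<Rightarrow> real) \<Rightarrow> 'a triple set \<Rightarrow> 'a triple \<Rightarrow> bool" where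
  "solves_VI \<Omega> \<beta> f K p \<longleftrightarrow>
     p \<in> K \<and> (\<forall>q\<in>K. b_form \<Omega> \<beta> p (q - p) \<ge> G_form \<Omega> \<beta> f (q - p))"

end

theory Submission
  imports Defs "HOL-Computational_Algebra.Polynomial"
begin

text \<open>
  The estimate is a Falk-type argument for a coercive, bounded, non-symmetric form.  Write
  \<open>p = (u, \<sigma>, l)\<close> for the solution and \<open>p_h\<close> for the discrete one.

  Coercivity (\<open>b_form_coercive\<close>): in \<open>b(p, p)\<close> the indefinite term is
  \<open>\<langle>l, u\<rangle> = (div \<sigma> + l, u) + (\<sigma>, \<nabla>u)\<close>.  Friedrichs' inequality bounds the first summand by
  \<open>C_F \<parallel>div \<sigma> + l\<parallel> \<parallel>\<nabla>u\<parallel>\<close>, and the weight \<open>\<beta> \<ge> 1 + C_F\<^sup>2\<close> is what absorbs it; the second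
  combines with the cross term of \<open>\<parallel>\<nabla>u - \<sigma>\<parallel>\<^sup>2\<close> to leave a definite quadratic form.

  Consistency (\<open>VI_residual_eq_multiplier\<close>): the set \<open>K0\<close> restricts only the first component,
  so the flux and the multiplier of \<open>p\<close> may be varied freely.  This forces
  \<open>div \<sigma> + l = -f\<close> and \<open>\<sigma> = \<nabla>u\<close>, and the residual \<open>b(p, q) - G(q)\<close> collapses to
  \<open>\<langle>l, v\<rangle>\<close>, where \<open>v\<close> is the first component of \<open>q\<close>.

  Error bound (\<open>VI_error_bound\<close>): for \<open>q_h \<in> K_h\<close> split
  \<open>b(p - p_h, p - p_h) = b(p - p_h, p - q_h) + b(p - p_h, q_h - p_h)\<close>.  Boundedness and Young's
  inequality treat the first term.  By the discrete inequality and consistency the second is at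
  most \<open>\<langle>l, v_h - u_h\<rangle> = \<langle>l, v_h - u\<rangle> + \<langle>l, u - u_h\<rangle>\<close>, and for \<open>v\<close> from \<open>K0\<close> the sign
  \<open>\<langle>l, v - u\<rangle> \<ge> 0\<close> replaces \<open>u\<close> by \<open>v\<close> in the last pairing.

  Most of the text lies below this argument.  Weak gradients and the functions \<open>div \<sigma> + l\<close> are
  chosen representatives, so that the forms are linear in the triples only once these
  representatives are known to be unique up to null sets.  That follows from the fundamental
  lemma of the calculus of variations (\<open>fundamental_lemma_variations\<close>), which needs smooth
  bumps with support in a box, and from the fact that test functions belong to \<open>H10\<close>
  (\<open>test_function_H10\<close>), which needs integration by parts.
\<close>

section \<open>Square-integrable functions\<close>

lemma L2_measurable: "f \<in> L2 \<Omega> \<Longrightarrow> f \<in> borel_measurable (lebesgue_on \<Omega>)"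
  by (simp add: L2_def)

lemma L2_integrable_inner:
  assumes "f \<in> L2 \<Omega>" "g \<in> L2 \<Omega>"
  shows "integrable (lebesgue_on \<Omega>) (\<lambda>x. f x \<bullet> g x)"
proof (rule Bochner_Integration.integrable_bound)
  show "integrable (lebesgue_on \<Omega>) (\<lambda>x. (norm (f x))\<^sup>2 + (norm (g x))\<^sup>2)"
    using assms by (simp add: L2_def)
  show "(\<lambda>x. f x \<bullet> g x) \<in> borel_measurable (lebesgue_on \<Omega>)"
    using assms[THEN L2_measurable] by simp
  have "norm (f x \<bullet> g x) \<le> norm ((norm (f x))\<^sup>2 + (norm (g x))\<^sup>2)" for x
  proof -
    have "\<bar>f x \<bullet> g x\<bar> \<le> norm (f x) * norm (g x)"
      by (rule Cauchy_Schwarz_ineq2)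
    moreover have "2 * (norm (f x) * norm (g x)) \<le> (norm (f x))\<^sup>2 + (norm (g x))\<^sup>2"
      using zero_le_power2[of "norm (f x) - norm (g x)"] by (simp add: power2_diff algebra_simps)
    moreover have "0 \<le> norm (f x) * norm (g x)" by simp
    ultimately have "\<bar>f x \<bullet> g x\<bar> \<le> (norm (f x))\<^sup>2 + (norm (g x))\<^sup>2" by linarith
    then show ?thesis by simp
  qed
  then show "AE x in lebesgue_on \<Omega>. norm (f x \<bullet> g x) \<le> norm ((norm (f x))\<^sup>2 + (norm (g x))\<^sup>2)"
    by simp
qed

lemma L2_integrable_mult:
  fixes f g :: "'a::euclidean_space \<Rightarrow> real"
  assumes "f \<in> L2 \<Omega>" "g \<in> L2 \<Omega>"
  shows "integrable (lebesgue_on \<Omega>) (\<lambda>x. f x * g x)"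
  using L2_integrable_inner[OF assms] by simp

lemma L2_add:
  assumes "f \<in> L2 \<Omega>" "g \<in> L2 \<Omega>"
  shows "f + g \<in> L2 \<Omega>"
proof -
  have "integrable (lebesgue_on \<Omega>)
      (\<lambda>x. f x \<bullet> f x + 2 * (f x \<bullet> g x) + g x \<bullet> g x)"
    using assms by (intro Bochner_Integration.integrable_add integrable_mult_right L2_integrable_inner)
  moreover have "(\<lambda>x. f x \<bullet> f x + 2 * (f x \<bullet> g x) + g x \<bullet> g x) = (\<lambda>x. (norm ((f + g) x))\<^sup>2)"
    by (auto simp: power2_norm_eq_inner inner_add_left inner_add_right inner_commute)
  ultimately have "integrable (lebesgue_on \<Omega>) (\<lambda>x. (norm ((f + g) x))\<^sup>2)" by simp
  then show ?thesis using assms[THEN L2_measurable] by (simp add: L2_def plus_fun_def)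
qed

lemma L2_scaleR:
  assumes "f \<in> L2 \<Omega>"
  shows "c *\<^sub>R f \<in> L2 \<Omega>"
  using assms by (auto simp: L2_def scaleR_fun_def power_mult_distrib)

lemma L2_diff:
  assumes "f \<in> L2 \<Omega>" "g \<in> L2 \<Omega>"
  shows "f - g \<in> L2 \<Omega>"
  using L2_add[OF assms(1) L2_scaleR[OF assms(2), of "-1"]] by simp

lemma L2_component:
  assumes "G \<in> L2 \<Omega>"
  shows "(\<lambda>x. G x \<bullet> i) \<in> L2 \<Omega>"
proof -
  have m: "(\<lambda>x. G x \<bullet> i) \<in> borel_measurable (lebesgue_on \<Omega>)"
    using assms[THEN L2_measurable] by simp
  have "integrable (lebesgue_on \<Omega>) (\<lambda>x. (norm (G x \<bullet> i))\<^sup>2)"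
  proof (rule Bochner_Integration.integrable_bound)
    show "integrable (lebesgue_on \<Omega>) (\<lambda>x. (norm i)\<^sup>2 * (norm (G x))\<^sup>2)"
      using assms by (simp add: L2_def)
    show "(\<lambda>x. (norm (G x \<bullet> i))\<^sup>2) \<in> borel_measurable (lebesgue_on \<Omega>)"
      using m by simp
    have "(norm (G x \<bullet> i))\<^sup>2 \<le> (norm i)\<^sup>2 * (norm (G x))\<^sup>2" for x
      using power_mono[OF Cauchy_Schwarz_ineq2[of "G x" i], of 2]
      by (simp add: power_mult_distrib mult.commute)
    then show "AE x in lebesgue_on \<Omega>. norm ((norm (G x \<bullet> i))\<^sup>2) \<le> norm ((norm i)\<^sup>2 * (norm (G x))\<^sup>2)"
      by simp
  qed
  with m show ?thesis by (simp add: L2_def)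
qed

lemma L2_inner_commute: "L2_inner \<Omega> f g = L2_inner \<Omega> g f"
  by (simp add: L2_inner_def inner_commute)

lemma L2_inner_add_left:
  assumes "f \<in> L2 \<Omega>" "g \<in> L2 \<Omega>" "h \<in> L2 \<Omega>"
  shows "L2_inner \<Omega> (f + g) h = L2_inner \<Omega> f h + L2_inner \<Omega> g h"
  using assms by (simp add: L2_inner_def inner_add_left L2_integrable_inner)

lemma L2_inner_scaleR_left: "L2_inner \<Omega> (c *\<^sub>R f) h = c * L2_inner \<Omega> f h"
  by (simp add: L2_inner_def scaleR_fun_def)

lemma L2_inner_add_right:
  assumes "f \<in> L2 \<Omega>" "g \<in> L2 \<Omega>" "h \<in> L2 \<Omega>"
  shows "L2_inner \<Omega> h (f + g) = L2_inner \<Omega> h f + L2_inner \<Omega> h g"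
  using L2_inner_add_left[OF assms] by (simp add: L2_inner_commute)

lemma L2_inner_scaleR_right: "L2_inner \<Omega> h (c *\<^sub>R f) = c * L2_inner \<Omega> h f"
  using L2_inner_scaleR_left by (metis L2_inner_commute)

lemma L2_inner_diff_left:
  assumes "f \<in> L2 \<Omega>" "g \<in> L2 \<Omega>" "h \<in> L2 \<Omega>"
  shows "L2_inner \<Omega> (f - g) h = L2_inner \<Omega> f h - L2_inner \<Omega> g h"
  using assms by (simp add: L2_inner_def inner_diff_left L2_integrable_inner)

lemma L2_inner_diff_right:
  assumes "f \<in> L2 \<Omega>" "g \<in> L2 \<Omega>" "h \<in> L2 \<Omega>"
  shows "L2_inner \<Omega> h (f - g) = L2_inner \<Omega> h f - L2_inner \<Omega> h g"
  using L2_inner_diff_left[OF assms] by (simp add: L2_inner_commute)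

lemma L2_inner_cong_AE:
  assumes "f \<in> L2 \<Omega>" "f' \<in> L2 \<Omega>" "h \<in> L2 \<Omega>" "AE x in lebesgue_on \<Omega>. f x = f' x"
  shows "L2_inner \<Omega> f h = L2_inner \<Omega> f' h"
  unfolding L2_inner_def
proof (rule integral_cong_AE)
  show "(\<lambda>x. f x \<bullet> h x) \<in> borel_measurable (lebesgue_on \<Omega>)"
       "(\<lambda>x. f' x \<bullet> h x) \<in> borel_measurable (lebesgue_on \<Omega>)"
    using assms(1-3)[THEN L2_measurable] by simp_all
  show "AE x in lebesgue_on \<Omega>. f x \<bullet> h x = f' x \<bullet> h x" using assms(4) by auto
qed

lemma L2_inner_self_nonneg: "0 \<le> L2_inner \<Omega> f f"
  by (simp add: L2_inner_def)

lemma L2_norm_nonneg: "0 \<le> L2_norm \<Omega> f"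
  by (simp add: L2_norm_def L2_inner_self_nonneg)

lemma L2_norm_sq: "(L2_norm \<Omega> f)\<^sup>2 = L2_inner \<Omega> f f"
  by (simp add: L2_norm_def L2_inner_self_nonneg)

lemma L2_norm_scaleR: "L2_norm \<Omega> (c *\<^sub>R f) = \<bar>c\<bar> * L2_norm \<Omega> f"
proof -
  have "L2_inner \<Omega> (c *\<^sub>R f) (c *\<^sub>R f) = c\<^sup>2 * L2_inner \<Omega> f f"
    by (simp only: L2_inner_scaleR_left L2_inner_scaleR_right) (simp add: power2_eq_square)
  then show ?thesis by (simp add: L2_norm_def real_sqrt_mult)
qed

lemma L2_norm_cong_AE:
  assumes "f \<in> L2 \<Omega>" "f' \<in> L2 \<Omega>" "AE x in lebesgue_on \<Omega>. f x = f' x"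
  shows "L2_norm \<Omega> f = L2_norm \<Omega> f'"
proof -
  have "L2_inner \<Omega> f f = L2_inner \<Omega> f' f"
    using assms by (intro L2_inner_cong_AE)
  also have "\<dots> = L2_inner \<Omega> f' f'"
    using L2_inner_cong_AE[OF assms(1,2,2,3)] by (simp add: L2_inner_commute)
  finally show ?thesis by (simp add: L2_norm_def)
qed

lemma L2_Cauchy_Schwarz:
  assumes "f \<in> L2 \<Omega>" "g \<in> L2 \<Omega>"
  shows "\<bar>L2_inner \<Omega> f g\<bar> \<le> L2_norm \<Omega> f * L2_norm \<Omega> g"
proof -
  define a b c where "a = L2_inner \<Omega> f f" and "b = L2_inner \<Omega> f g" and "c = L2_inner \<Omega> g g"
  have quad: "0 \<le> a + 2 * t * b + t\<^sup>2 * c" for t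
  proof -
    have tg: "t *\<^sub>R g \<in> L2 \<Omega>" and s: "f + t *\<^sub>R g \<in> L2 \<Omega>"
      using assms by (auto intro: L2_add L2_scaleR)
    have "L2_inner \<Omega> (f + t *\<^sub>R g) (f + t *\<^sub>R g) =
        L2_inner \<Omega> f (f + t *\<^sub>R g) + L2_inner \<Omega> (t *\<^sub>R g) (f + t *\<^sub>R g)"
      by (rule L2_inner_add_left[OF assms(1) tg s])
    also have "\<dots> = a + 2 * t * b + t\<^sup>2 * c"
      unfolding L2_inner_scaleR_left L2_inner_add_right[OF assms(1) tg assms(1)]
        L2_inner_add_right[OF assms(1) tg assms(2)] L2_inner_scaleR_right L2_inner_commute[of \<Omega> g f] a_def b_def c_def
      by (simp add: power2_eq_square algebra_simps)
    finally show ?thesis using L2_inner_self_nonneg[of \<Omega> "f + t *\<^sub>R g"] by simp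
  qed
  have "b\<^sup>2 \<le> a * c"
  proof (cases "c = 0")
    case True
    \<comment> \<open>With \<open>c = 0\<close> the quadratic is affine and nonnegative, hence constant.\<close>
    have "b = 0"
    proof (rule ccontr)
      assume "b \<noteq> 0"
      then show False using quad[of "- (a + 1) / (2 * b)"] True by (simp add: field_simps)
    qed
    with True show ?thesis by simp
  next
    case False
    then have "c > 0" using L2_inner_self_nonneg[of \<Omega> g] by (simp add: c_def)
    then show ?thesis using quad[of "- b / c"] by (simp add: field_simps power2_eq_square)
  qed
  then have "\<bar>b\<bar> \<le> sqrt (a * c)"
    by (metis real_sqrt_abs real_sqrt_le_mono)
  then show ?thesis by (simp add: L2_norm_def real_sqrt_mult a_def b_def c_def)
qed

lemma L2_norm_triangle:
  assumes "f \<in> L2 \<Omega>" "g \<in> L2 \<Omega>"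
  shows "L2_norm \<Omega> (f + g) \<le> L2_norm \<Omega> f + L2_norm \<Omega> g"
proof (rule power2_le_imp_le)
  have "(L2_norm \<Omega> (f + g))\<^sup>2 = (L2_norm \<Omega> f)\<^sup>2 + 2 * L2_inner \<Omega> f g + (L2_norm \<Omega> g)\<^sup>2"
    using assms by (simp add: L2_norm_sq L2_inner_add_left L2_inner_add_right L2_add
        L2_inner_commute[of \<Omega> g f])
  also have "\<dots> \<le> (L2_norm \<Omega> f + L2_norm \<Omega> g)\<^sup>2"
    using L2_Cauchy_Schwarz[OF assms] by (simp add: power2_sum)
  finally show "(L2_norm \<Omega> (f + g))\<^sup>2 \<le> (L2_norm \<Omega> f + L2_norm \<Omega> g)\<^sup>2" .
  show "0 \<le> L2_norm \<Omega> f + L2_norm \<Omega> g" by (simp add: L2_norm_nonneg)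
qed

section \<open>Smooth bump functions\<close>

lemma Ck_lower: "Ck (Suc k) f \<Longrightarrow> Ck k f"
proof (induction k arbitrary: f)
  case 0
  then show ?case
    by (auto simp: continuous_on_eq_continuous_at intro: differentiable_imp_continuous_within)
next
  case (Suc k)
  then show ?case by (subst Ck.simps) (auto simp del: Ck.simps(1) simp: Ck.simps(2)[of "Suc k"])
qed

lemma Ck_const: "Ck k (\<lambda>x. c)"
  by (induction k arbitrary: c) (auto simp: frechet_derivative_const)

lemma Ck_add: "Ck k f \<Longrightarrow> Ck k g \<Longrightarrow> Ck k (\<lambda>x. f x + g x)"
proof (induction k arbitrary: f g)
  case 0
  then show ?case by (auto intro: continuous_intros)
next
  case (Suc k)
  then have d: "f differentiable (at x)" "g differentiable (at x)" for x by auto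
  have "frechet_derivative (\<lambda>x. f x + g x) (at x)
      = (\<lambda>h. frechet_derivative f (at x) h + frechet_derivative g (at x) h)" for x
    using d[of x] by (intro frechet_derivative_at[symmetric])
      (auto intro!: has_derivative_add simp: frechet_derivative_works[symmetric])
  then show ?case using Suc d by auto
qed

lemma Ck_mult: "Ck k f \<Longrightarrow> Ck k g \<Longrightarrow> Ck k (\<lambda>x. f x * g x)"
proof (induction k arbitrary: f g)
  case 0
  then show ?case by (auto intro: continuous_intros)
next
  case (Suc k)
  then have d: "f differentiable (at x)" "g differentiable (at x)" for x by auto
  have fd: "frechet_derivative (\<lambda>x. f x * g x) (at x)
      = (\<lambda>h. f x * frechet_derivative g (at x) h + frechet_derivative f (at x) h * g x)" for x
    using d[of x] by (intro frechet_derivative_at[symmetric])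
      (auto intro!: has_derivative_mult simp: frechet_derivative_works[symmetric])
  have lower: "Ck k f" "Ck k g" using Suc.prems by (auto intro: Ck_lower)
  have "Ck k (\<lambda>x. f x * frechet_derivative g (at x) i + frechet_derivative f (at x) i * g x)"
    if "i \<in> Basis" for i
    using Suc.prems that lower by (intro Ck_add Suc.IH) auto
  then show ?case using d by (auto simp: fd)
qed

lemma Ck_prod:
  "finite I \<Longrightarrow> (\<And>i. i \<in> I \<Longrightarrow> Ck k (f i)) \<Longrightarrow> Ck k (\<lambda>x. \<Prod>i\<in>I. f i x)"
  by (induction I rule: finite_induct) (auto simp: Ck_const intro: Ck_mult)

text \<open>
  Along a linear functional every partial derivative of \<open>D n\<close> is a constant multiple of
  \<open>D (Suc n)\<close>, so the statement for all \<open>n\<close> at once is inductive in \<open>k\<close>.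
\<close>

lemma Ck_compose_inner:
  fixes D :: "nat \<Rightarrow> real \<Rightarrow> real"
  assumes "\<And>n t. (D n has_real_derivative D (Suc n) t) (at t)"
  shows "Ck k (\<lambda>x::'a::euclidean_space. D n (x \<bullet> v + d))"
proof (induction k arbitrary: n)
  case 0
  have "isCont (D n) t" for t using assms DERIV_isCont by blast
  then have "continuous_on UNIV (D n)" by (simp add: continuous_on_eq_continuous_at)
  then have "continuous_on UNIV (\<lambda>x. D n (x \<bullet> v + d))"
    by (rule continuous_on_compose2) (auto intro!: continuous_intros)
  then show ?case by simp
next
  case (Suc k)
  have der: "((\<lambda>x. D n (x \<bullet> v + d)) has_derivative (\<lambda>h. (h \<bullet> v) * D (Suc n) (x \<bullet> v + d))) (at x)"
    for x :: 'a
  proof -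
    have "((\<lambda>x. x \<bullet> v + d) has_derivative (\<lambda>h. h \<bullet> v)) (at x)"
      by (auto intro!: derivative_eq_intros)
    from has_derivative_compose[OF this assms[unfolded has_field_derivative_def]]
    show ?thesis by (simp add: mult.commute)
  qed
  have "Ck k (\<lambda>x. (i \<bullet> v) * D (Suc n) (x \<bullet> v + d))" for i
    by (intro Ck_mult Ck_const Suc.IH)
  then show ?case
    using der by (auto simp: frechet_derivative_at[OF der, symmetric] intro: differentiableI)
qed

text \<open>
  The derivatives of \<open>exp (-1/t)\<close>, extended by zero, are of the form \<open>P(1/t) exp (-1/t)\<close> with
  polynomials \<open>P\<close>.  Taking \<open>P\<close> as a parameter makes this family closed under differentiation,
  and the exponential decay makes each member differentiable at the origin.
\<close>

definition flat_exp :: "real poly \<Rightarrow> real \<Rightarrow> real" where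
  "flat_exp P t = (if 0 < t then poly P (1 / t) * exp (- (1 / t)) else 0)"

lemma poly_div_exp_at_top: "((\<lambda>y::real. poly P y / exp y) \<longlongrightarrow> 0) at_top"
proof -
  have "((\<lambda>y::real. \<Sum>i\<le>degree P. coeff P i * (y ^ i / exp y)) \<longlongrightarrow> (\<Sum>i\<le>degree P. coeff P i * 0)) at_top"
    by (intro tendsto_sum tendsto_mult tendsto_const tendsto_power_div_exp_0)
  then show ?thesis by (simp add: poly_altdef sum_divide_distrib)
qed

lemma flat_exp_tendsto_0: "(flat_exp P \<longlongrightarrow> 0) (at 0)"
proof (rule filterlim_split_at_real)
  have "((\<lambda>t::real. poly P (inverse t) / exp (inverse t)) \<longlongrightarrow> 0) (at_right 0)"
    by (rule filterlim_compose[OF poly_div_exp_at_top filterlim_inverse_at_top_right])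
  then show "(flat_exp P \<longlongrightarrow> 0) (at_right 0)"
    by (rule Lim_transform_eventually)
      (auto simp: eventually_at_filter flat_exp_def exp_minus field_simps)
  show "(flat_exp P \<longlongrightarrow> 0) (at_left 0)"
    by (rule Lim_transform_eventually[OF tendsto_const])
      (auto simp: eventually_at_filter flat_exp_def)
qed

lemma flat_exp_has_derivative:
  "(flat_exp P has_real_derivative flat_exp ([:0, 0, 1:] * (P - pderiv P)) t) (at t)"
proof -
  consider "t > 0" | "t < 0" | "t = 0" by linarith
  then show ?thesis
  proof cases
    case 1
    have "((\<lambda>t. poly P (1 / t) * exp (- (1 / t))) has_real_derivative
        flat_exp ([:0, 0, 1:] * (P - pderiv P)) t) (at t)"
      using 1 by (auto intro!: derivative_eq_intros DERIV_chain'[OF _ poly_DERIV, where f="\<lambda>t. 1 / t"]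
          simp: flat_exp_def field_simps power2_eq_square)
    then show ?thesis
      by (rule DERIV_cong_ev[THEN iffD1, OF refl _ refl, rotated])
        (use 1 eventually_nhds_in_open[of "{0<..}" t] in
          \<open>auto elim!: eventually_mono simp: flat_exp_def\<close>)
  next
    case 2
    have "((\<lambda>t::real. 0::real) has_real_derivative
        flat_exp ([:0, 0, 1:] * (P - pderiv P)) t) (at t)"
      using 2 by (simp add: flat_exp_def)
    then show ?thesis
      by (rule DERIV_cong_ev[THEN iffD1, OF refl _ refl, rotated])
        (use 2 eventually_nhds_in_open[of "{..<0}" t] in
          \<open>auto elim!: eventually_mono simp: flat_exp_def\<close>)
  next
    case 3
    \<comment> \<open>The difference quotient at the origin is again a flat function.\<close>
    have "(flat_exp P h - flat_exp P 0) / (h - 0) = flat_exp ([:0, 1:] * P) h" for h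
      by (simp add: flat_exp_def)
    then show ?thesis
      using flat_exp_tendsto_0[of "[:0, 1:] * P"] 3
      by (simp add: has_field_derivative_iff flat_exp_def[of _ 0])
  qed
qed

lemma flat_exp_1_bounds: "0 \<le> flat_exp 1 t" "flat_exp 1 t \<le> 1"
  by (auto simp: flat_exp_def)

lemma flat_exp_1_eq_0_iff: "flat_exp 1 t = 0 \<longleftrightarrow> t \<le> 0"
  by (auto simp: flat_exp_def)

lemma flat_exp_1_tendsto_1:
  assumes "0 < s"
  shows "(\<lambda>k. flat_exp 1 (real (Suc k) * s)) \<longlonglongrightarrow> 1"
proof -
  have "(\<lambda>k. exp (- (inverse (real (Suc k)) / s))) \<longlonglongrightarrow> exp (- (0 / s))"
    by (intro tendsto_intros LIMSEQ_inverse_real_of_nat) (use assms in auto)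
  moreover have "flat_exp 1 (real (Suc k) * s) = exp (- (inverse (real (Suc k)) / s))" for k
    using assms by (simp add: flat_exp_def inverse_eq_divide del: of_nat_Suc)
  ultimately show ?thesis by simp
qed

lemma smooth_flat_exp_1_inner: "smooth (\<lambda>x::'a::euclidean_space. flat_exp 1 (x \<bullet> v + d))"
proof -
  define D :: "nat \<Rightarrow> real poly" where "D n = ((\<lambda>P. [:0, 0, 1:] * (P - pderiv P)) ^^ n) 1" for n
  have "(flat_exp (D n) has_real_derivative flat_exp (D (Suc n)) t) (at t)" for n t
    using flat_exp_has_derivative[of "D n" t] by (simp add: D_def)
  then have "Ck k (\<lambda>x::'a. flat_exp (D 0) (x \<bullet> v + d))" for k
    by (rule Ck_compose_inner[where D="\<lambda>n. flat_exp (D n)"])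
  then show ?thesis by (simp add: smooth_def D_def)
qed

text \<open>
  Positivity of all factors describes the box; letting \<open>k\<close> grow drives each factor to \<open>1\<close>
  inside, so these smooth functions approximate the indicator of the box from below.
\<close>

definition box_bump :: "'a::euclidean_space \<Rightarrow> 'a \<Rightarrow> nat \<Rightarrow> 'a \<Rightarrow> real" where
  "box_bump a b k x = (\<Prod>i\<in>Basis. flat_exp 1 (real (Suc k) * (x \<bullet> i - a \<bullet> i)) *
                                   flat_exp 1 (real (Suc k) * (b \<bullet> i - x \<bullet> i)))"

lemma box_bump_smooth: "smooth (box_bump a b k)"
proof -
  have eq: "flat_exp 1 (real (Suc k) * (x \<bullet> i - a \<bullet> i)) =
        flat_exp 1 (x \<bullet> (real (Suc k) *\<^sub>R i) + - (real (Suc k) * (a \<bullet> i)))"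
      "flat_exp 1 (real (Suc k) * (b \<bullet> i - x \<bullet> i)) =
        flat_exp 1 (x \<bullet> (- real (Suc k) *\<^sub>R i) + real (Suc k) * (b \<bullet> i))" for x i
    by (simp_all add: algebra_simps)
  show ?thesis
    unfolding box_bump_def eq smooth_def
    by (intro allI Ck_prod Ck_mult finite_Basis smooth_flat_exp_1_inner[unfolded smooth_def, rule_format])
qed

lemma box_bump_bounds: "0 \<le> box_bump a b k x" "box_bump a b k x \<le> 1"
  unfolding box_bump_def
  by (auto intro!: prod_nonneg prod_le_1 mult_le_one simp: flat_exp_1_bounds)

lemma box_bump_support: "{x. box_bump a b k x \<noteq> 0} = box a b"
  by (auto simp: box_bump_def flat_exp_1_eq_0_iff box_def zero_less_mult_iff not_le
      mult_le_0_iff)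

lemma box_bump_tendsto: "(\<lambda>k. box_bump a b k x) \<longlonglongrightarrow> indicat_real (box a b) x"
proof (cases "x \<in> box a b")
  case True
  then have "(\<lambda>k. box_bump a b k x) \<longlonglongrightarrow> (\<Prod>i\<in>(Basis::'a set). 1 * 1)"
    unfolding box_bump_def by (intro tendsto_prod tendsto_mult flat_exp_1_tendsto_1)
      (auto simp: box_def)
  with True show ?thesis by simp
next
  case False
  then have "box_bump a b k x = 0" for k using box_bump_support[of a b k] by blast
  with False show ?thesis by simp
qed

lemma box_bump_test_function:
  assumes "cbox a b \<subseteq> \<Omega>"
  shows "box_bump a b k \<in> test_functions \<Omega>"
proof -
  have "closure (box a b) \<subseteq> cbox a b" by (simp add: box_subset_cbox closure_minimal closed_cbox)
  then show ?thesis
    using assms unfolding test_functions_def mem_Collect_eq box_bump_support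
    by (auto simp: box_bump_smooth bounded_subset[OF bounded_cbox] compact_closure bounded_box)
qed

section \<open>The fundamental lemma of the calculus of variations\<close>

text \<open>
  Boxes are closed under intersection and generate the Borel sets, so Dynkin's lemma applies.
  The complement step needs the integral over the whole space, a limit of integrals over
  growing boxes.
\<close>

lemma zero_on_boxes_imp_zero_on_borel:
  fixes f :: "'a::euclidean_space \<Rightarrow> real"
  assumes int: "integrable lebesgue f"
    and box: "\<And>a b. (LINT x:box a b|lebesgue. f x) = 0"
    and A: "A \<in> sets borel"
  shows "(LINT x:A|lebesgue. f x) = 0"
proof -
  have si: "set_integrable lebesgue S f" if "S \<in> sets borel" for S
    using int that unfolding set_integrable_def by (intro integrable_mult_indicator) auto
  have univ: "(LINT x|lebesgue. f x) = 0"
  proof -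
    let ?B = "\<lambda>i::nat. box (- (real i *\<^sub>R One)) (real i *\<^sub>R One) :: 'a set"
    have "(\<lambda>i. LINT x|lebesgue. indicator (?B i) x *\<^sub>R f x) \<longlonglongrightarrow> (LINT x|lebesgue. f x)"
    proof (rule integral_dominated_convergence[where w="\<lambda>x. norm (f x)"])
      show "AE x in lebesgue. (\<lambda>i. indicator (?B i) x *\<^sub>R f x) \<longlonglongrightarrow> f x"
      proof (rule AE_I2)
        fix x :: 'a
        from UN_box_eq_UNIV obtain i where i: "x \<in> ?B i" by blast
        have "x \<in> ?B j" if "i \<le> j" for j
        proof -
          have "real i \<le> real j" using that by simp
          with i show ?thesis by (fastforce simp: box_def)
        qed
        then have "eventually (\<lambda>j. f x = indicator (?B j) x *\<^sub>R f x) sequentially"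
          by (auto simp: eventually_sequentially intro!: exI[of _ i])
        then show "(\<lambda>i. indicator (?B i) x *\<^sub>R f x) \<longlonglongrightarrow> f x"
          by (rule Lim_transform_eventually[OF tendsto_const])
      qed
      show "(\<lambda>x. indicator (?B i) x *\<^sub>R f x) \<in> borel_measurable lebesgue" for i
        using int by (intro borel_measurable_integrable integrable_mult_indicator) auto
    qed (use int in \<open>auto simp: indicator_def\<close>)
    then show ?thesis
      using box by (simp add: set_lebesgue_integral_def LIMSEQ_const_iff)
  qed
  have "Int_stable (range (\<lambda>(a, b). box a b :: 'a set))"
    by (auto simp: Int_stable_def box_Int_box)
  moreover have "range (\<lambda>(a, b). box a b :: 'a set) \<subseteq> Pow UNIV" by simp
  moreover have "A \<in> sigma_sets UNIV (range (\<lambda>(a, b). box a b))"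
    using A by (subst (asm) borel_eq_box) (simp add: sets_measure_of)
  ultimately show ?thesis
  proof (induction rule: sigma_sets_induct_disjoint)
    case (basic A)
    then show ?case using box by auto
  next
    case empty
    show ?case by (simp add: set_lebesgue_integral_def)
  next
    case (compl A)
    then have m: "A \<in> sets borel" by (subst borel_eq_box) (simp add: sets_measure_of)
    have "(LINT x:A \<union> (UNIV - A)|lebesgue. f x) = (LINT x:A|lebesgue. f x) + (LINT x:UNIV - A|lebesgue. f x)"
      using m by (intro set_integral_Un si) auto
    then show ?case using compl univ by (simp add: set_lebesgue_integral_def)
  next
    case (union A)
    then have m: "A i \<in> sets borel" for i by (subst borel_eq_box) (auto simp: sets_measure_of)
    have "(LINT x:(\<Union>i. A i)|lebesgue. f x) = (\<Sum>i. LINT x:A i|lebesgue. f x)"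
      using union(1) m by (intro lebesgue_integral_countable_add si) (auto simp: disjoint_family_on_def)
    then show ?case using union by simp
  qed
qed

text \<open>
  A Lebesgue set differs from a Borel set by a null set; applied to the sets where \<open>f\<close> and
  \<open>-f\<close> are positive, the vanishing of all Borel integrals leaves nothing of either sign.
\<close>

lemma AE_zero_of_box_integrals:
  fixes f :: "'a::euclidean_space \<Rightarrow> real"
  assumes int: "integrable lebesgue f"
    and box: "\<And>a b. (LINT x:box a b|lebesgue. f x) = 0"
  shows "AE x in lebesgue. f x = 0"
proof -
  have le: "AE x in lebesgue. g x \<le> 0"
    if g: "integrable lebesgue g" "\<And>a b. (LINT x:box a b|lebesgue. g x) = 0"
    for g :: "'a \<Rightarrow> real"
  proof -
    have "{x. 0 < g x} \<in> sets lebesgue"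
      using borel_measurable_integrable[OF g(1)] borel_measurable_less[of "\<lambda>_. 0" lebesgue g] by simp
    then obtain S N N' where S: "{x. 0 < g x} = S \<union> N" "N \<subseteq> N'" "N' \<in> null_sets lborel" "S \<in> sets lborel"
      by (rule sets_completionE)
    have i: "integrable lebesgue (\<lambda>x. indicator S x *\<^sub>R g x)"
      using g(1) S(4) by (intro integrable_mult_indicator) auto
    have "(LINT x|lebesgue. indicator S x *\<^sub>R g x) = 0"
      using zero_on_boxes_imp_zero_on_borel[OF g, of S] S(4)
      by (simp add: set_lebesgue_integral_def)
    moreover have "0 \<le> indicator S x *\<^sub>R g x" for x
    proof (cases "x \<in> S")
      case True
      then have "0 < g x" using S(1) by blast
      then show ?thesis by simp
    qed simp
    ultimately have "AE x in lebesgue. indicator S x *\<^sub>R g x = 0"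
      using integral_nonneg_eq_0_iff_AE[OF i] by simp
    moreover have "AE x in lebesgue. x \<notin> N'"
      using S(3) by (intro AE_not_in) (simp add: null_sets_completionI)
    ultimately show ?thesis
    proof eventually_elim
      case (elim x)
      then show ?case using S(1,2) by (cases "0 < g x") (auto simp: indicator_def split: if_splits)
    qed
  qed
  have "AE x in lebesgue. f x \<le> 0" by (rule le[OF assms])
  moreover have "AE x in lebesgue. - f x \<le> 0"
    using int box by (intro le) (auto simp: set_lebesgue_integral_def)
  ultimately show ?thesis by eventually_elim simp
qed

lemma bounded_support_L2:
  assumes "\<Omega> \<in> sets lebesgue" "g \<in> borel_measurable lebesgue"
    and bd: "\<And>x. norm (g x) \<le> B * indicator (cbox a b) x"
  shows "g \<in> L2 \<Omega>"
proof -
  have "integrable lebesgue (\<lambda>x. (norm (g x))\<^sup>2)"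
  proof (rule Bochner_Integration.integrable_bound)
    show "integrable lebesgue (\<lambda>x. B\<^sup>2 * indicat_real (cbox a b) x)"
      by (intro integrable_mult_right) (simp add: emeasure_lborel_cbox_eq)
    show "(\<lambda>x. (norm (g x))\<^sup>2) \<in> borel_measurable lebesgue" using assms(2) by simp
    have "(norm (g x))\<^sup>2 \<le> B\<^sup>2 * indicat_real (cbox a b) x" for x
      using power_mono[OF bd[of x], of 2] by (auto simp: indicator_def split: if_splits)
    then show "AE x in lebesgue. norm ((norm (g x))\<^sup>2) \<le> norm (B\<^sup>2 * indicat_real (cbox a b) x)"
      by (auto simp: abs_mult)
  qed
  then have "integrable (lebesgue_on \<Omega>) (\<lambda>x. (norm (g x))\<^sup>2)"
    using integrable_mult_indicator[OF assms(1), of "\<lambda>x. (norm (g x))\<^sup>2"] assms(1)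
    by (simp add: integrable_restrict_space)
  then show ?thesis
    using assms(2) by (simp add: L2_def measurable_restrict_space1)
qed

lemma box_indicator_L2: "\<Omega> \<in> sets lebesgue \<Longrightarrow> indicat_real (box a b) \<in> L2 \<Omega>"
proof (rule bounded_support_L2)
  show "norm (indicat_real (box a b) x) \<le> 1 * indicator (cbox a b) x" for x
    using box_subset_cbox[of a b] by (auto simp: indicator_def)
  show "indicat_real (box a b) \<in> borel_measurable lebesgue"
    by (rule borel_measurable_indicator) auto
qed

lemma box_integral_zero:
  fixes f :: "'a::euclidean_space \<Rightarrow> real"
  assumes op: "open \<Omega>" and f: "f \<in> L2 \<Omega>" and ab: "cbox a b \<subseteq> \<Omega>"
    and orth: "\<And>\<phi>. \<phi> \<in> test_functions \<Omega> \<Longrightarrow> (LINT x|lebesgue_on \<Omega>. f x * \<phi> x) = 0"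
  shows "(LINT x|lebesgue_on \<Omega>. f x * indicat_real (box a b) x) = 0"
proof -
  have L: "\<Omega> \<in> sets lebesgue" using op by auto
  have ind: "indicat_real (box a b) \<in> L2 \<Omega>" by (rule box_indicator_L2[OF L])
  have bump: "box_bump a b k \<in> L2 \<Omega>" for k
  proof (rule bounded_support_L2[OF L])
    have "continuous_on UNIV (box_bump a b k)"
      using box_bump_smooth[of a b k] by (metis Ck.simps(1) smooth_def)
    then show "box_bump a b k \<in> borel_measurable lebesgue"
      by (simp add: borel_measurable_continuous_onI measurable_completion)
    show "norm (box_bump a b k x) \<le> 1 * indicator (cbox a b) x" for x
      using box_bump_support[of a b k] box_bump_bounds[of a b k x] box_subset_cbox[of a b]
      by (auto simp: indicator_def)
  qed
  have "(\<lambda>k. LINT x|lebesgue_on \<Omega>. f x * box_bump a b k x)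
      \<longlonglongrightarrow> (LINT x|lebesgue_on \<Omega>. f x * indicat_real (box a b) x)"
  proof (rule integral_dominated_convergence[where w="\<lambda>x. norm (f x * indicat_real (box a b) x)"])
    show "AE x in lebesgue_on \<Omega>. norm (f x * box_bump a b k x) \<le> norm (f x * indicat_real (box a b) x)" for k
    proof (rule AE_I2)
      fix x
      show "norm (f x * box_bump a b k x) \<le> norm (f x * indicat_real (box a b) x)"
      proof (cases "x \<in> box a b")
        case True
        then show ?thesis
          using box_bump_bounds[of a b k x] by (simp add: abs_mult mult_left_le)
      next
        case False
        then have "box_bump a b k x = 0" using box_bump_support[of a b k] by blast
        then show ?thesis by simp
      qed
    qed
    show "AE x in lebesgue_on \<Omega>. (\<lambda>k. f x * box_bump a b k x) \<longlonglongrightarrow> f x * indicat_real (box a b) x"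
      by (intro AE_I2 tendsto_intros box_bump_tendsto)
    show "integrable (lebesgue_on \<Omega>) (\<lambda>x. norm (f x * indicat_real (box a b) x))"
      by (intro integrable_norm L2_integrable_mult f ind)
    show "(\<lambda>x. f x * indicat_real (box a b) x) \<in> borel_measurable (lebesgue_on \<Omega>)"
      by (rule borel_measurable_integrable[OF L2_integrable_mult[OF f ind]])
    show "(\<lambda>x. f x * box_bump a b k x) \<in> borel_measurable (lebesgue_on \<Omega>)" for k
      by (rule borel_measurable_integrable[OF L2_integrable_mult[OF f bump]])
  qed
  moreover have "(LINT x|lebesgue_on \<Omega>. f x * box_bump a b k x) = 0" for k
    by (intro orth box_bump_test_function ab)
  ultimately show ?thesis by (simp add: LIMSEQ_const_iff)
qed

text \<open>
  The bumps turn orthogonality to test functions into vanishing box integrals, but only for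
  boxes whose closure lies in \<open>\<Omega>\<close>.  Hence \<open>f\<close> is first cut off to such a box; intersections of
  other boxes with it are again admissible.  Countably many closed boxes exhaust \<open>\<Omega>\<close>.
\<close>

lemma fundamental_lemma_variations:
  fixes f :: "'a::euclidean_space \<Rightarrow> real"
  assumes op: "open \<Omega>" and f: "f \<in> L2 \<Omega>"
    and orth: "\<And>\<phi>. \<phi> \<in> test_functions \<Omega> \<Longrightarrow> (LINT x|lebesgue_on \<Omega>. f x * \<phi> x) = 0"
  shows "AE x in lebesgue_on \<Omega>. f x = 0"
proof -
  have L: "\<Omega> \<in> sets lebesgue" using op by auto
  have loc: "AE x in lebesgue. x \<in> cbox c d \<longrightarrow> f x = 0" if cd: "cbox c d \<subseteq> \<Omega>" for c d
  proof -
    \<comment> \<open>The open box, so that its intersection with any open box is again an open box.\<close>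
    define F where "F x = indicat_real (box c d) x * f x" for x
    have sub: "box c d \<subseteq> \<Omega>" using cd box_subset_cbox by blast
    have ind: "indicat_real (box c d) \<in> L2 \<Omega>" by (rule box_indicator_L2[OF L])
    have eq: "indicator \<Omega> x *\<^sub>R (f x * indicat_real (box c d \<inter> S) x) = indicator S x *\<^sub>R F x" for x S
      using sub by (auto simp: F_def indicator_def)
    have "integrable lebesgue F"
      using L2_integrable_mult[OF f ind] L eq[of _ UNIV]
      by (subst (asm) integrable_restrict_space) auto
    moreover have "(LINT x:box a b|lebesgue. F x) = 0" for a b
    proof -
      obtain a' b' where ab: "box c d \<inter> box a b = box a' b'" by (rule that[OF box_Int_box])
      have "(LINT x|lebesgue_on \<Omega>. f x * indicat_real (box a' b') x) = 0"
      proof (cases "box a' b' = {}")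
        case False
        then have "cbox a' b' = closure (box a' b')" by simp
        also have "\<dots> \<subseteq> cbox c d"
          using ab box_subset_cbox[of c d] by (intro closure_minimal) auto
        finally show ?thesis using cd by (intro box_integral_zero op f orth) auto
      qed simp
      then show ?thesis
        using L eq[of _ "box a b"] ab by (simp add: integral_restrict_space set_lebesgue_integral_def)
    qed
    ultimately have "AE x in lebesgue. F x = 0" by (rule AE_zero_of_box_integrals)
    moreover have "AE x in lebesgue. x \<notin> cbox c d - box c d"
      by (intro AE_not_in) (simp add: negligible_frontier_interval flip: negligible_iff_null_sets)
    ultimately show ?thesis by eventually_elim (auto simp: F_def)
  qed
  obtain D where D: "countable D" "D \<subseteq> Pow \<Omega>" "\<And>X. X \<in> D \<Longrightarrow> \<exists>a b. X = cbox a b" "\<Union>D = \<Omega>"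
    by (rule open_countable_Union_open_cbox[OF op]) blast
  have "AE x in lebesgue. \<forall>X\<in>D. x \<in> X \<longrightarrow> f x = 0"
    unfolding AE_ball_countable[OF D(1)]
  proof
    fix X assume "X \<in> D"
    then obtain c d where "X = cbox c d" "cbox c d \<subseteq> \<Omega>" using D(2,3) by blast
    with loc show "AE x in lebesgue. x \<in> X \<longrightarrow> f x = 0" by blast
  qed
  then have "AE x in lebesgue. x \<in> \<Omega> \<longrightarrow> f x = 0"
    by eventually_elim (use D(4) in auto)
  then show ?thesis using L by (subst AE_restrict_space_iff) auto
qed

section \<open>Weak gradients of test functions\<close>

lemma compact_support_bound:
  fixes h :: "'a::euclidean_space \<Rightarrow> 'b::real_normed_vector"
  assumes c: "continuous_on UNIV h" and K: "compact K" "\<And>x. x \<notin> K \<Longrightarrow> h x = 0"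
  obtains B a where "0 \<le> B" "\<And>x. norm (h x) \<le> B * indicator (cbox (- a) a) x"
proof -
  obtain a where a: "K \<subseteq> cbox (- a) a"
    using bounded_subset_cbox_symmetric[OF compact_imp_bounded[OF K(1)]] by blast
  have "bounded (h ` K)"
    using c K(1) by (intro compact_imp_bounded compact_continuous_image) (auto intro: continuous_on_subset)
  then obtain B where B: "\<And>x. x \<in> K \<Longrightarrow> norm (h x) \<le> B" by (auto simp: bounded_iff)
  have "norm (h x) \<le> max 0 B * indicator (cbox (- a) a) x" for x
  proof (cases "x \<in> K")
    case True
    then have "x \<in> cbox (- a) a" "norm (h x) \<le> max 0 B" using a B[of x] by auto
    then show ?thesis by (simp only: indicator_simps mult_1_right)
  qed (simp add: K(2))
  then show ?thesis by (intro that[of "max 0 B" a]) auto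
qed

lemma compact_support_L2:
  fixes h :: "'a::euclidean_space \<Rightarrow> 'b::euclidean_space"
  assumes c: "continuous_on UNIV h" and K: "compact K" "\<And>x. x \<notin> K \<Longrightarrow> h x = 0"
    and "\<Omega> \<in> sets lebesgue"
  shows "h \<in> L2 \<Omega>"
proof -
  obtain B a where "0 \<le> B" "\<And>x. norm (h x) \<le> B * indicator (cbox (- a) a) x"
    using compact_support_bound[OF c K] by blast
  then show ?thesis
    using assms by (intro bounded_support_L2[where B=B and a="-a" and b=a])
      (auto simp: borel_measurable_continuous_onI measurable_completion)
qed

lemma integral_lborel_shift:
  fixes h :: "'a::euclidean_space \<Rightarrow> real"
  assumes "h \<in> borel_measurable borel"
  shows "(LINT x|lborel. h (c + x)) = (LINT x|lborel. h x)"
proof -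
  have "(LINT x|lborel. h x) = (LINT x|distr lborel borel ((+) c). h x)"
    by (simp add: lborel_distr_plus)
  also have "\<dots> = (LINT x|lborel. h (c + x))"
    using assms by (subst integral_distr) auto
  finally show ?thesis by simp
qed

lemma frechet_derivative_zero_outside:
  fixes h :: "'a::real_normed_vector \<Rightarrow> 'b::real_normed_vector"
  assumes "closed K" "\<And>x. x \<notin> K \<Longrightarrow> h x = 0" "x \<notin> K"
  shows "frechet_derivative h (at x) = (\<lambda>_. 0)"
proof -
  have "(h has_derivative (\<lambda>_. 0)) (at x)"
    by (rule has_derivative_transform_within_open[OF has_derivative_const[of 0], of "- K"])
      (use assms in \<open>auto simp: open_Compl\<close>)
  then show ?thesis by (rule frechet_derivative_at[symmetric])
qed

text \<open>
  The integral of a difference quotient is a difference of two equal integrals, and the quotients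
  converge boundedly to the directional derivative.  Translation invariance thus replaces an
  iterated integration along coordinate lines.
\<close>

lemma integral_derivative_compact_support:
  fixes h :: "'a::euclidean_space \<Rightarrow> real"
  assumes d: "\<And>x. h differentiable (at x)"
    and c: "continuous_on UNIV (\<lambda>x. frechet_derivative h (at x) e)"
    and K: "compact K" "\<And>x. x \<notin> K \<Longrightarrow> h x = 0"
  shows "(LINT x|lebesgue. frechet_derivative h (at x) e) = 0"
proof -
  define D where "D x = frechet_derivative h (at x) e" for x
  have hc: "continuous_on UNIV h"
    using d by (simp add: continuous_on_eq_continuous_at differentiable_imp_continuous_within)
  then have hm: "h \<in> borel_measurable borel" by (rule borel_measurable_continuous_onI)
  have Dm: "D \<in> borel_measurable borel"
    using c unfolding D_def by (rule borel_measurable_continuous_onI)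
  have line: "((\<lambda>s. h (x + s *\<^sub>R e)) has_real_derivative D (x + s *\<^sub>R e)) (at s)" for x s
  proof -
    have "((\<lambda>s. x + s *\<^sub>R e) has_derivative (\<lambda>t. t *\<^sub>R e)) (at s)"
      by (auto intro!: derivative_eq_intros)
    from has_derivative_compose[OF this frechet_derivative_works[THEN iffD1, OF d]]
    have *: "((\<lambda>s. h (x + s *\<^sub>R e)) has_derivative
        (\<lambda>t. frechet_derivative h (at (x + s *\<^sub>R e)) (t *\<^sub>R e))) (at s)" .
    have "linear (frechet_derivative h (at (x + s *\<^sub>R e)))"
      using d by (rule linear_frechet_derivative)
    then have "(\<lambda>t. frechet_derivative h (at (x + s *\<^sub>R e)) (t *\<^sub>R e)) = (*) (D (x + s *\<^sub>R e))"
      by (auto simp: linear_cmul D_def)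
    with * show ?thesis by (simp add: has_field_derivative_def)
  qed
  have Dz: "D x = 0" if "x \<notin> K" for x
    using frechet_derivative_zero_outside[OF compact_imp_closed[OF K(1)] K(2) that]
    by (simp add: D_def)
  obtain M a where M: "0 \<le> M" "\<And>x. norm (D x) \<le> M * indicator (cbox (- a) a) x"
    using compact_support_bound[OF c[folded D_def] K(1) Dz] by blast
  obtain R where R: "\<And>x. x \<in> K \<Longrightarrow> norm x \<le> R"
    using compact_imp_bounded[OF K(1)] by (auto simp: bounded_iff)
  \<comment> \<open>Steps of size at most \<open>1\<close> keep the supports of all difference quotients in one ball.\<close>
  define t where "t k = inverse (real (Suc k))" for k
  have t: "0 < t k" "t k \<le> 1" for k by (auto simp: t_def field_simps)
  have t0: "t \<longlonglongrightarrow> 0" using LIMSEQ_inverse_real_of_nat by (simp add: t_def[abs_def])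
  define q where "q k x = (h (t k *\<^sub>R e + x) - h x) / t k" for k x
  have hi: "integrable lborel h"
  proof -
    have "integrable lborel (\<lambda>x. indicator K x *\<^sub>R h x)"
      using K(1) hc by (intro borel_integrable_compact) (auto intro: continuous_on_subset)
    moreover have "indicator K x *\<^sub>R h x = h x" for x
      using K(2) by (cases "x \<in> K") auto
    ultimately show ?thesis
      by (rule Bochner_Integration.integrable_cong[THEN iffD1, OF refl, rotated])
  qed
  have hsi: "integrable lborel (\<lambda>x. h (c + x))" for c
  proof -
    have "integrable (distr lborel borel ((+) c)) h" by (subst lborel_distr_plus) (rule hi)
    then show ?thesis by (rule integrable_distr[rotated]) simp
  qed
  have q0: "(LINT x|lborel. q k x) = 0" for k
    using hi hsi hm by (simp add: q_def integral_lborel_shift)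
  have "(\<lambda>k. LINT x|lborel. q k x) \<longlonglongrightarrow> (LINT x|lborel. D x)"
  proof (rule integral_dominated_convergence[where w="\<lambda>x. M * indicat_real (cball 0 (R + norm e)) x"])
    show "D \<in> borel_measurable lborel" using Dm by simp
    show "q k \<in> borel_measurable lborel" for k
      unfolding q_def using hm by simp
    show "integrable lborel (\<lambda>x. M * indicat_real (cball 0 (R + norm e)) x)"
      by (intro integrable_mult_right integrable_real_indicator)
        (use emeasure_bounded_finite[OF bounded_cball] in \<open>auto simp: less_top\<close>)
    show "AE x in lborel. (\<lambda>k. q k x) \<longlonglongrightarrow> D x"
    proof (rule AE_I2)
      fix x
      have "((\<lambda>s. (h (x + s *\<^sub>R e) - h (x + 0 *\<^sub>R e)) / s) \<longlongrightarrow> D (x + 0 *\<^sub>R e)) (at 0)"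
        using line[of x 0, unfolded has_field_derivative_iff] by simp
      moreover have "filterlim t (at 0) sequentially"
        using t0 by (rule filterlim_atI) (simp add: t_def)
      ultimately have "(\<lambda>k. (h (x + t k *\<^sub>R e) - h (x + 0 *\<^sub>R e)) / t k) \<longlonglongrightarrow> D (x + 0 *\<^sub>R e)"
        by (rule filterlim_compose)
      then show "(\<lambda>k. q k x) \<longlonglongrightarrow> D x" by (simp add: q_def add.commute)
    qed
    show "AE x in lborel. norm (q k x) \<le> M * indicat_real (cball 0 (R + norm e)) x" for k
    proof (rule AE_I2)
      fix x
      show "norm (q k x) \<le> M * indicat_real (cball 0 (R + norm e)) x"
      proof (cases "norm x \<le> R + norm e")
        case True
        obtain z where z: "h (x + t k *\<^sub>R e) - h (x + 0 *\<^sub>R e) = (t k - 0) * D (x + z *\<^sub>R e)"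
          using MVT2[of 0 "t k", OF t(1), of "\<lambda>s. h (x + s *\<^sub>R e)" "\<lambda>s. D (x + s *\<^sub>R e)"] line by blast
        then have "q k x = D (x + z *\<^sub>R e)" using t(1)[of k] by (simp add: q_def add.commute)
        moreover have "M * indicat_real (cbox (- a) a) (x + z *\<^sub>R e) \<le> M"
          using M(1) by (cases "x + z *\<^sub>R e \<in> cbox (- a) a") auto
        ultimately have "norm (q k x) \<le> M" using M(2)[of "x + z *\<^sub>R e"] by simp
        then show ?thesis using True by simp
      next
        case False
        have "norm x \<le> norm (t k *\<^sub>R e + x) + norm (t k *\<^sub>R e)"
          using norm_triangle_ineq4[of "t k *\<^sub>R e + x" "t k *\<^sub>R e"] by simp
        moreover have "norm (t k *\<^sub>R e) \<le> norm e"
          using t[of k] by (simp add: mult_left_le_one_le)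
        ultimately have "\<not> norm x \<le> R" "\<not> norm (t k *\<^sub>R e + x) \<le> R"
          using False norm_ge_zero[of e] by linarith+
        then have "x \<notin> K" "t k *\<^sub>R e + x \<notin> K" using R by blast+
        then have "q k x = 0" using K(2) by (simp add: q_def)
        then show ?thesis using M(1) by (simp add: indicator_def)
      qed
    qed
  qed
  then have "(LINT x|lborel. D x) = 0" by (simp add: q0 LIMSEQ_const_iff)
  then have "(LINT x|lebesgue. D x) = 0" using Dm by (simp add: integral_completion)
  then show ?thesis by (simp add: D_def)
qed

lemma test_function_props:
  assumes "\<phi> \<in> test_functions \<Omega>"
  shows test_function_differentiable: "\<phi> differentiable (at x)"
    and test_function_continuous: "continuous_on UNIV \<phi>"
    and test_function_continuous_deriv:
      "i \<in> Basis \<Longrightarrow> continuous_on UNIV (\<lambda>x. frechet_derivative \<phi> (at x) i)"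
    and test_function_compact: "compact (closure {x. \<phi> x \<noteq> 0})"
    and test_function_subset: "closure {x. \<phi> x \<noteq> 0} \<subseteq> \<Omega>"
proof -
  have "Ck 0 \<phi>" "Ck (Suc 0) \<phi>" using assms by (auto simp: test_functions_def smooth_def simp del: Ck.simps)
  then show "\<phi> differentiable (at x)" "continuous_on UNIV \<phi>"
    "i \<in> Basis \<Longrightarrow> continuous_on UNIV (\<lambda>x. frechet_derivative \<phi> (at x) i)" by auto
qed (use assms[unfolded test_functions_def] in simp_all)

lemma test_function_zero: "x \<notin> closure {x. \<phi> x \<noteq> 0} \<Longrightarrow> \<phi> x = (0::real)"
  using closure_subset[of "{x. \<phi> x \<noteq> 0}"] by blast

lemma test_function_deriv_zero:
  assumes "x \<notin> closure {x. \<phi> x \<noteq> (0::real)}"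
  shows "frechet_derivative \<phi> (at x) = (\<lambda>_. 0)"
  by (rule frechet_derivative_zero_outside[OF closed_closure test_function_zero[of _ \<phi>] assms])

lemma test_function_L2:
  assumes "\<Omega> \<in> sets lebesgue" "\<phi> \<in> test_functions \<Omega>"
  shows "\<phi> \<in> L2 \<Omega>"
  by (rule compact_support_L2[OF test_function_continuous[OF assms(2)]
        test_function_compact[OF assms(2)] test_function_zero[of _ \<phi>] assms(1)])

lemma test_function_deriv_L2:
  assumes "\<Omega> \<in> sets lebesgue" "\<phi> \<in> test_functions \<Omega>" "i \<in> Basis"
  shows "(\<lambda>x. frechet_derivative \<phi> (at x) i) \<in> L2 \<Omega>"
  by (rule compact_support_L2[OF test_function_continuous_deriv[OF assms(2,3)]
        test_function_compact[OF assms(2)] _ assms(1)])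
    (simp add: test_function_deriv_zero)

definition classical_gradient :: "('a::euclidean_space \<Rightarrow> real) \<Rightarrow> 'a \<Rightarrow> 'a" where
  "classical_gradient \<phi> x = (\<Sum>i\<in>Basis. frechet_derivative \<phi> (at x) i *\<^sub>R i)"

text \<open>
  The derivative of the product \<open>\<phi> \<psi>\<close> has integral zero over the whole space, and it vanishes
  outside \<open>\<Omega>\<close>, so it also has integral zero over \<open>\<Omega>\<close>.
\<close>

lemma integration_by_parts_test_functions:
  assumes L: "\<Omega> \<in> sets lebesgue" and \<phi>: "\<phi> \<in> test_functions \<Omega>" and \<psi>: "\<psi> \<in> test_functions \<Omega>"
    and i: "i \<in> Basis"
  shows "(LINT x|lebesgue_on \<Omega>. \<phi> x * frechet_derivative \<psi> (at x) i)
       = - (LINT x|lebesgue_on \<Omega>. frechet_derivative \<phi> (at x) i * \<psi> x)"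
proof -
  have der: "frechet_derivative (\<lambda>x. \<phi> x * \<psi> x) (at x)
      = (\<lambda>h. \<phi> x * frechet_derivative \<psi> (at x) h + frechet_derivative \<phi> (at x) h * \<psi> x)" for x
    using test_function_differentiable[OF \<phi>] test_function_differentiable[OF \<psi>]
    by (intro frechet_derivative_at[symmetric])
      (auto intro!: has_derivative_mult simp: frechet_derivative_works[symmetric])
  have z: "\<phi> x * frechet_derivative \<psi> (at x) i + frechet_derivative \<phi> (at x) i * \<psi> x = 0"
    if "x \<notin> closure {x. \<phi> x \<noteq> 0}" for x
    using that test_function_zero[OF that] test_function_deriv_zero[OF that] by simp
  have "(LINT x|lebesgue. frechet_derivative (\<lambda>x. \<phi> x * \<psi> x) (at x) i) = 0"
  proof (rule integral_derivative_compact_support[OF _ _ test_function_compact[OF \<phi>]])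
    show "(\<lambda>x. \<phi> x * \<psi> x) differentiable (at x)" for x
      using test_function_differentiable[OF \<phi>] test_function_differentiable[OF \<psi>]
      by (intro differentiable_mult)
    show "continuous_on UNIV (\<lambda>x. frechet_derivative (\<lambda>x. \<phi> x * \<psi> x) (at x) i)"
      unfolding der using \<phi> \<psi> i
      by (intro continuous_intros) (auto intro: test_function_continuous test_function_continuous_deriv)
    show "\<phi> x * \<psi> x = 0" if "x \<notin> closure {x. \<phi> x \<noteq> 0}" for x
      by (subst test_function_zero[OF that]) simp
  qed
  then have int0: "(LINT x|lebesgue. \<phi> x * frechet_derivative \<psi> (at x) i + frechet_derivative \<phi> (at x) i * \<psi> x) = 0"
    by (simp only: der)
  have ind: "indicator \<Omega> x *\<^sub>R (\<phi> x * frechet_derivative \<psi> (at x) i + frechet_derivative \<phi> (at x) i * \<psi> x)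
      = \<phi> x * frechet_derivative \<psi> (at x) i + frechet_derivative \<phi> (at x) i * \<psi> x" for x
  proof (cases "x \<in> \<Omega>")
    case False
    then have "x \<notin> closure {x. \<phi> x \<noteq> 0}" using test_function_subset[OF \<phi>] by blast
    from z[OF this] show ?thesis by simp
  qed simp
  have "(LINT x|lebesgue_on \<Omega>.
      \<phi> x * frechet_derivative \<psi> (at x) i + frechet_derivative \<phi> (at x) i * \<psi> x) = 0"
    using L by (subst integral_restrict_space) (simp, simp only: ind int0)
  then show ?thesis
    using L2_integrable_mult[OF test_function_L2[OF L \<phi>] test_function_deriv_L2[OF L \<psi> i]]
      L2_integrable_mult[OF test_function_deriv_L2[OF L \<phi> i] test_function_L2[OF L \<psi>]]
    by (simp add: Bochner_Integration.integral_add)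
qed

lemma classical_gradient_L2:
  assumes "\<Omega> \<in> sets lebesgue" "\<phi> \<in> test_functions \<Omega>"
  shows "classical_gradient \<phi> \<in> L2 \<Omega>"
proof (rule compact_support_L2)
  show "continuous_on UNIV (classical_gradient \<phi>)"
    unfolding classical_gradient_def using assms(2)
    by (intro continuous_intros) (auto intro: test_function_continuous_deriv)
  show "classical_gradient \<phi> x = 0" if "x \<notin> closure {x. \<phi> x \<noteq> 0}" for x
    using test_function_deriv_zero[OF that] by (simp add: classical_gradient_def)
qed (use assms test_function_compact in auto)

lemma test_function_has_weak_gradient:
  assumes "\<Omega> \<in> sets lebesgue" "\<phi> \<in> test_functions \<Omega>"
  shows "has_weak_gradient \<Omega> \<phi> (classical_gradient \<phi>)"
proof -
  have "classical_gradient \<phi> x \<bullet> i = frechet_derivative \<phi> (at x) i" if "i \<in> Basis" for x i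
    using that by (simp add: classical_gradient_def inner_sum_left inner_Basis if_distrib
        cong: if_cong)
  then show ?thesis
    using assms unfolding has_weak_gradient_def
    by (auto simp: classical_gradient_L2 integration_by_parts_test_functions)
qed

section \<open>Uniqueness of the weak gradient and the space \<open>H\<^sub>0\<^sup>1\<close>\<close>

text \<open>
  Each component of the difference is orthogonal to all test functions.  This is what makes the
  chosen representative \<open>wgrad\<close> linear up to null sets.
\<close>

lemma weak_gradient_unique:
  assumes op: "open \<Omega>" and "has_weak_gradient \<Omega> u G" "has_weak_gradient \<Omega> u G'"
  shows "AE x in lebesgue_on \<Omega>. G x = G' x"
proof -
  have G: "G \<in> L2 \<Omega>" "G' \<in> L2 \<Omega>" using assms by (auto simp: has_weak_gradient_def)
  have L: "\<Omega> \<in> sets lebesgue" using op by auto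
  have "AE x in lebesgue_on \<Omega>. (G - G') x \<bullet> i = 0" if i: "i \<in> Basis" for i
  proof (rule fundamental_lemma_variations[OF op L2_component[OF L2_diff[OF G]]])
    fix \<phi> assume \<phi>: "\<phi> \<in> test_functions \<Omega>"
    have "(LINT x|lebesgue_on \<Omega>. u x * frechet_derivative \<phi> (at x) i)
        = - (LINT x|lebesgue_on \<Omega>. (G x \<bullet> i) * \<phi> x)"
      using assms(2) \<phi> i unfolding has_weak_gradient_def by blast
    moreover have "(LINT x|lebesgue_on \<Omega>. u x * frechet_derivative \<phi> (at x) i)
        = - (LINT x|lebesgue_on \<Omega>. (G' x \<bullet> i) * \<phi> x)"
      using assms(3) \<phi> i unfolding has_weak_gradient_def by blast
    ultimately have "(LINT x|lebesgue_on \<Omega>. (G x \<bullet> i) * \<phi> x) = (LINT x|lebesgue_on \<Omega>. (G' x \<bullet> i) * \<phi> x)"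
      by linarith
    then show "(LINT x|lebesgue_on \<Omega>. ((G - G') x \<bullet> i) * \<phi> x) = 0"
      using L2_integrable_mult[OF L2_component[OF G(1)] test_function_L2[OF L \<phi>], of i]
        L2_integrable_mult[OF L2_component[OF G(2)] test_function_L2[OF L \<phi>], of i]
      by (simp add: inner_diff_left left_diff_distrib)
  qed
  then have "AE x in lebesgue_on \<Omega>. \<forall>i\<in>Basis. (G - G') x \<bullet> i = 0"
    by (simp add: AE_ball_countable countable_finite)
  then show ?thesis
  proof eventually_elim
    case (elim x)
    show ?case
    proof (rule euclidean_eqI)
      fix i :: 'a assume "i \<in> Basis"
      with elim have "(G - G') x \<bullet> i = 0" by blast
      then show "G x \<bullet> i = G' x \<bullet> i" by (simp add: inner_diff_left)
    qed
  qed
qed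

lemma has_weak_gradient_wgrad:
  assumes "u \<in> H1 \<Omega>"
  shows "has_weak_gradient \<Omega> u (wgrad \<Omega> u)"
proof -
  have "\<exists>G. has_weak_gradient \<Omega> u G" using assms by (simp add: H1_def)
  then show ?thesis unfolding wgrad_def by (rule someI_ex)
qed

lemma H1_L2: "u \<in> H1 \<Omega> \<Longrightarrow> u \<in> L2 \<Omega>"
  by (simp add: H1_def)

lemma wgrad_L2: "u \<in> H1 \<Omega> \<Longrightarrow> wgrad \<Omega> u \<in> L2 \<Omega>"
  using has_weak_gradient_wgrad by (auto simp: has_weak_gradient_def)

lemma has_weak_gradient_add:
  assumes L: "\<Omega> \<in> sets lebesgue" and u: "u \<in> L2 \<Omega>" "has_weak_gradient \<Omega> u G"
    and v: "v \<in> L2 \<Omega>" "has_weak_gradient \<Omega> v H"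
  shows "has_weak_gradient \<Omega> (u + v) (G + H)"
  unfolding has_weak_gradient_def
proof (intro conjI ballI)
  have G: "G \<in> L2 \<Omega>" and H: "H \<in> L2 \<Omega>" using u v by (auto simp: has_weak_gradient_def)
  then show "G + H \<in> L2 \<Omega>" by (rule L2_add)
  fix \<phi> i assume \<phi>: "\<phi> \<in> test_functions \<Omega>" and i: "(i::'a) \<in> Basis"
  note int =
    L2_integrable_mult[OF u(1) test_function_deriv_L2[OF L \<phi> i]]
    L2_integrable_mult[OF v(1) test_function_deriv_L2[OF L \<phi> i]]
    L2_integrable_mult[OF L2_component[OF G] test_function_L2[OF L \<phi>], of i]
    L2_integrable_mult[OF L2_component[OF H] test_function_L2[OF L \<phi>], of i]
  have "(LINT x|lebesgue_on \<Omega>. u x * frechet_derivative \<phi> (at x) i)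
          = - (LINT x|lebesgue_on \<Omega>. (G x \<bullet> i) * \<phi> x)"
       "(LINT x|lebesgue_on \<Omega>. v x * frechet_derivative \<phi> (at x) i)
          = - (LINT x|lebesgue_on \<Omega>. (H x \<bullet> i) * \<phi> x)"
    using u(2) v(2) \<phi> i by (auto simp: has_weak_gradient_def)
  then show "(LINT x|lebesgue_on \<Omega>. (u + v) x * frechet_derivative \<phi> (at x) i)
          = - (LINT x|lebesgue_on \<Omega>. ((G + H) x \<bullet> i) * \<phi> x)"
    using int by (simp add: distrib_right inner_add_left)
qed

lemma has_weak_gradient_scaleR:
  assumes "has_weak_gradient \<Omega> u G"
  shows "has_weak_gradient \<Omega> (c *\<^sub>R u) (c *\<^sub>R G)"
  unfolding has_weak_gradient_def
proof (intro conjI ballI)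
  show "c *\<^sub>R G \<in> L2 \<Omega>" using assms by (intro L2_scaleR) (simp add: has_weak_gradient_def)
  fix \<phi> i assume "\<phi> \<in> test_functions \<Omega>" "(i::'a) \<in> Basis"
  then have "(LINT x|lebesgue_on \<Omega>. u x * frechet_derivative \<phi> (at x) i)
      = - (LINT x|lebesgue_on \<Omega>. (G x \<bullet> i) * \<phi> x)"
    using assms unfolding has_weak_gradient_def by blast
  then show "(LINT x|lebesgue_on \<Omega>. (c *\<^sub>R u) x * frechet_derivative \<phi> (at x) i)
      = - (LINT x|lebesgue_on \<Omega>. ((c *\<^sub>R G) x \<bullet> i) * \<phi> x)"
    by (simp add: scaleR_fun_def mult.assoc)
qed

lemma H1_add:
  assumes "\<Omega> \<in> sets lebesgue" "u \<in> H1 \<Omega>" "v \<in> H1 \<Omega>"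
  shows "u + v \<in> H1 \<Omega>"
proof -
  obtain G H where "has_weak_gradient \<Omega> u G" "has_weak_gradient \<Omega> v H"
    using assms by (auto simp: H1_def)
  then have "has_weak_gradient \<Omega> (u + v) (G + H)"
    using assms by (intro has_weak_gradient_add) (auto simp: H1_def)
  moreover have "u + v \<in> L2 \<Omega>" using assms by (intro L2_add) (auto simp: H1_def)
  ultimately show ?thesis unfolding H1_def by blast
qed

lemma H1_scaleR:
  assumes "u \<in> H1 \<Omega>"
  shows "c *\<^sub>R u \<in> H1 \<Omega>"
proof -
  obtain G where "has_weak_gradient \<Omega> u G" using assms by (auto simp: H1_def)
  then have "has_weak_gradient \<Omega> (c *\<^sub>R u) (c *\<^sub>R G)" by (rule has_weak_gradient_scaleR)
  moreover have "c *\<^sub>R u \<in> L2 \<Omega>" using assms by (intro L2_scaleR) (auto simp: H1_def)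
  ultimately show ?thesis unfolding H1_def by blast
qed

lemma wgrad_add:
  assumes "open \<Omega>" "u \<in> H1 \<Omega>" "v \<in> H1 \<Omega>"
  shows "AE x in lebesgue_on \<Omega>. wgrad \<Omega> (u + v) x = (wgrad \<Omega> u + wgrad \<Omega> v) x"
proof -
  have "\<Omega> \<in> sets lebesgue" using assms(1) by auto
  then show ?thesis
    using assms by (intro weak_gradient_unique[OF assms(1), of "u + v"] has_weak_gradient_wgrad
        has_weak_gradient_add H1_add H1_L2)
qed

lemma wgrad_scaleR:
  assumes "open \<Omega>" "u \<in> H1 \<Omega>"
  shows "AE x in lebesgue_on \<Omega>. wgrad \<Omega> (c *\<^sub>R u) x = (c *\<^sub>R wgrad \<Omega> u) x"
  by (rule weak_gradient_unique[OF assms(1) has_weak_gradient_wgrad[OF H1_scaleR[OF assms(2)]]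
        has_weak_gradient_scaleR[OF has_weak_gradient_wgrad[OF assms(2)]]])

lemma L2_norm_wgrad_add:
  assumes "open \<Omega>" "u \<in> H1 \<Omega>" "v \<in> H1 \<Omega>"
  shows "L2_norm \<Omega> (wgrad \<Omega> (u + v)) \<le> L2_norm \<Omega> (wgrad \<Omega> u) + L2_norm \<Omega> (wgrad \<Omega> v)"
proof -
  have "\<Omega> \<in> sets lebesgue" using assms(1) by auto
  then have "L2_norm \<Omega> (wgrad \<Omega> (u + v)) = L2_norm \<Omega> (wgrad \<Omega> u + wgrad \<Omega> v)"
    using assms by (intro L2_norm_cong_AE wgrad_add wgrad_L2 L2_add H1_add)
  also have "\<dots> \<le> L2_norm \<Omega> (wgrad \<Omega> u) + L2_norm \<Omega> (wgrad \<Omega> v)"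
    using assms by (intro L2_norm_triangle wgrad_L2)
  finally show ?thesis .
qed

lemma L2_norm_wgrad_scaleR:
  assumes "open \<Omega>" "u \<in> H1 \<Omega>"
  shows "L2_norm \<Omega> (wgrad \<Omega> (c *\<^sub>R u)) = \<bar>c\<bar> * L2_norm \<Omega> (wgrad \<Omega> u)"
proof -
  have "L2_norm \<Omega> (wgrad \<Omega> (c *\<^sub>R u)) = L2_norm \<Omega> (c *\<^sub>R wgrad \<Omega> u)"
    by (rule L2_norm_cong_AE[OF wgrad_L2[OF H1_scaleR[OF assms(2)]]
          L2_scaleR[OF wgrad_L2[OF assms(2)]] wgrad_scaleR[OF assms]])
  then show ?thesis by (simp only: L2_norm_scaleR)
qed

lemma H1_norm_nonneg: "0 \<le> H1_norm \<Omega> u"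
  by (simp add: H1_norm_def)

lemma H1_norm_triangle:
  assumes "open \<Omega>" "u \<in> H1 \<Omega>" "v \<in> H1 \<Omega>"
  shows "H1_norm \<Omega> (u + v) \<le> H1_norm \<Omega> u + H1_norm \<Omega> v"
proof -
  have "H1_norm \<Omega> (u + v) \<le> sqrt ((L2_norm \<Omega> u + L2_norm \<Omega> v)\<^sup>2
      + (L2_norm \<Omega> (wgrad \<Omega> u) + L2_norm \<Omega> (wgrad \<Omega> v))\<^sup>2)"
    unfolding H1_norm_def using assms
    by (intro real_sqrt_le_mono add_mono power_mono L2_norm_triangle L2_norm_wgrad_add
        L2_norm_nonneg H1_L2)
  also have "\<dots> \<le> H1_norm \<Omega> u + H1_norm \<Omega> v"
    unfolding H1_norm_def by (rule real_sqrt_sum_squares_triangle_ineq)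
  finally show ?thesis .
qed

lemma H1_norm_scaleR:
  assumes "open \<Omega>" "u \<in> H1 \<Omega>"
  shows "H1_norm \<Omega> (c *\<^sub>R u) = \<bar>c\<bar> * H1_norm \<Omega> u"
proof -
  have "H1_norm \<Omega> (c *\<^sub>R u) = sqrt (\<bar>c\<bar>\<^sup>2 * ((L2_norm \<Omega> u)\<^sup>2 + (L2_norm \<Omega> (wgrad \<Omega> u))\<^sup>2))"
    unfolding H1_norm_def L2_norm_scaleR L2_norm_wgrad_scaleR[OF assms]
    by (simp only: power_mult_distrib distrib_left)
  then show ?thesis by (simp add: H1_norm_def real_sqrt_mult)
qed

lemma L2_norm_le_H1_norm: "L2_norm \<Omega> u \<le> H1_norm \<Omega> u"
  by (simp add: H1_norm_def L2_norm_nonneg real_le_rsqrt)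

lemma L2_norm_wgrad_le_H1_norm: "L2_norm \<Omega> (wgrad \<Omega> u) \<le> H1_norm \<Omega> u"
  by (simp add: H1_norm_def L2_norm_nonneg real_le_rsqrt)

lemma test_functions_add:
  assumes "\<phi> \<in> test_functions \<Omega>" "\<psi> \<in> test_functions \<Omega>"
  shows "\<phi> + \<psi> \<in> test_functions \<Omega>"
proof -
  have "closure {x. (\<phi> + \<psi>) x \<noteq> 0} \<subseteq> closure ({x. \<phi> x \<noteq> 0} \<union> {x. \<psi> x \<noteq> 0})"
    by (intro closure_mono) auto
  then have sub: "closure {x. (\<phi> + \<psi>) x \<noteq> 0} \<subseteq> closure {x. \<phi> x \<noteq> 0} \<union> closure {x. \<psi> x \<noteq> 0}"
    by (simp only: closure_Un)
  have "compact (closure {x. \<phi> x \<noteq> 0} \<union> closure {x. \<psi> x \<noteq> 0})"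
    using assms by (intro compact_Un test_function_compact)
  then have "compact (closure {x. (\<phi> + \<psi>) x \<noteq> 0})"
    using sub by (metis closed_closure compact_Int_closed inf.absorb_iff2)
  moreover have "closure {x. (\<phi> + \<psi>) x \<noteq> 0} \<subseteq> \<Omega>"
    using sub assms[THEN test_function_subset] by blast
  moreover have "smooth (\<phi> + \<psi>)"
    using assms by (auto simp: test_functions_def smooth_def plus_fun_def intro: Ck_add)
  ultimately show ?thesis by (simp only: test_functions_def mem_Collect_eq)
qed

lemma test_functions_scaleR:
  assumes "\<phi> \<in> test_functions \<Omega>"
  shows "c *\<^sub>R \<phi> \<in> test_functions \<Omega>"
proof -
  have sub: "closure {x. (c *\<^sub>R \<phi>) x \<noteq> 0} \<subseteq> closure {x. \<phi> x \<noteq> 0}"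
    by (intro closure_mono) (auto simp: scaleR_fun_def)
  then have "compact (closure {x. (c *\<^sub>R \<phi>) x \<noteq> 0})"
    using test_function_compact[OF assms] by (metis closed_closure compact_Int_closed inf.absorb_iff2)
  moreover have "closure {x. (c *\<^sub>R \<phi>) x \<noteq> 0} \<subseteq> \<Omega>"
    using sub test_function_subset[OF assms] by blast
  moreover have "smooth (c *\<^sub>R \<phi>)"
    using assms by (auto simp: test_functions_def smooth_def scaleR_fun_def intro: Ck_mult Ck_const)
  ultimately show ?thesis by (simp only: test_functions_def mem_Collect_eq)
qed

lemma test_function_H1:
  assumes "\<Omega> \<in> sets lebesgue" "\<phi> \<in> test_functions \<Omega>"
  shows "\<phi> \<in> H1 \<Omega>"
  using test_function_L2[OF assms] test_function_has_weak_gradient[OF assms] by (auto simp: H1_def)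

lemma H10_H1: "v \<in> H10 \<Omega> \<Longrightarrow> v \<in> H1 \<Omega>"
  by (simp add: H10_def)

lemma H10_L2: "v \<in> H10 \<Omega> \<Longrightarrow> v \<in> L2 \<Omega>"
  by (intro H1_L2 H10_H1)

lemma H1_diff:
  assumes "\<Omega> \<in> sets lebesgue" "u \<in> H1 \<Omega>" "v \<in> H1 \<Omega>"
  shows "u - v \<in> H1 \<Omega>"
  using H1_add[OF assms(1,2) H1_scaleR[OF assms(3), of "-1"]] by simp

text \<open>
  The approximating sequence is constant, but \<open>\<phi> - \<phi>\<close> has \<open>H\<^sup>1\<close> norm zero only because the
  representative \<open>wgrad \<Omega> 0\<close> vanishes almost everywhere.
\<close>

lemma test_function_H10:
  assumes op: "open \<Omega>" and \<phi>: "\<phi> \<in> test_functions \<Omega>"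
  shows "\<phi> \<in> H10 \<Omega>"
proof -
  have "\<phi> \<in> H1 \<Omega>" using op \<phi> by (intro test_function_H1) auto
  moreover from H1_norm_scaleR[OF op this, of 0] have "H1_norm \<Omega> (\<phi> - \<phi>) = 0" by simp
  ultimately show ?thesis using \<phi> by (auto simp: H10_def intro!: exI[of _ "\<lambda>_. \<phi>"])
qed

lemma H10_add:
  assumes op: "open \<Omega>" and u: "u \<in> H10 \<Omega>" and v: "v \<in> H10 \<Omega>"
  shows "u + v \<in> H10 \<Omega>"
proof -
  have L: "\<Omega> \<in> sets lebesgue" using op by auto
  obtain \<phi> where \<phi>: "\<And>k. \<phi> k \<in> test_functions \<Omega>" "(\<lambda>k. H1_norm \<Omega> (\<phi> k - u)) \<longlonglongrightarrow> 0"
    using u unfolding H10_def by blast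
  obtain \<psi> where \<psi>: "\<And>k. \<psi> k \<in> test_functions \<Omega>" "(\<lambda>k. H1_norm \<Omega> (\<psi> k - v)) \<longlonglongrightarrow> 0"
    using v unfolding H10_def by blast
  have "(\<lambda>k. H1_norm \<Omega> ((\<phi> k + \<psi> k) - (u + v))) \<longlonglongrightarrow> 0"
  proof (rule tendsto_sandwich[OF _ _ tendsto_const])
    show "(\<lambda>k. H1_norm \<Omega> (\<phi> k - u) + H1_norm \<Omega> (\<psi> k - v)) \<longlonglongrightarrow> 0"
      using tendsto_add[OF \<phi>(2) \<psi>(2)] by simp
    have "H1_norm \<Omega> ((\<phi> k + \<psi> k) - (u + v)) \<le> H1_norm \<Omega> (\<phi> k - u) + H1_norm \<Omega> (\<psi> k - v)" for k
    proof -
      have "(\<phi> k + \<psi> k) - (u + v) = (\<phi> k - u) + (\<psi> k - v)" by simp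
      moreover have "H1_norm \<Omega> ((\<phi> k - u) + (\<psi> k - v)) \<le> H1_norm \<Omega> (\<phi> k - u) + H1_norm \<Omega> (\<psi> k - v)"
        using u v \<phi>(1) \<psi>(1) L by (intro H1_norm_triangle[OF op] H1_diff test_function_H1 H10_H1)
      ultimately show ?thesis by (simp only:)
    qed
    then show "\<forall>\<^sub>F k in sequentially. H1_norm \<Omega> ((\<phi> k + \<psi> k) - (u + v)) \<le>
        H1_norm \<Omega> (\<phi> k - u) + H1_norm \<Omega> (\<psi> k - v)"
      by (intro always_eventually allI)
  qed (intro always_eventually allI H1_norm_nonneg)
  moreover have "u + v \<in> H1 \<Omega>" using L u v by (intro H1_add H10_H1)
  moreover have "\<phi> k + \<psi> k \<in> test_functions \<Omega>" for k using \<phi>(1) \<psi>(1) by (intro test_functions_add)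
  ultimately show ?thesis
    unfolding H10_def by (auto intro!: exI[of _ "\<lambda>k. \<phi> k + \<psi> k"])
qed

lemma H10_scaleR:
  assumes op: "open \<Omega>" and u: "u \<in> H10 \<Omega>"
  shows "c *\<^sub>R u \<in> H10 \<Omega>"
proof -
  have L: "\<Omega> \<in> sets lebesgue" using op by auto
  obtain \<phi> where \<phi>: "\<And>k. \<phi> k \<in> test_functions \<Omega>" "(\<lambda>k. H1_norm \<Omega> (\<phi> k - u)) \<longlonglongrightarrow> 0"
    using u unfolding H10_def by blast
  have eq: "H1_norm \<Omega> (c *\<^sub>R \<phi> k - c *\<^sub>R u) = \<bar>c\<bar> * H1_norm \<Omega> (\<phi> k - u)" for k
  proof -
    have "\<phi> k - u \<in> H1 \<Omega>" using L u \<phi>(1) by (intro H1_diff test_function_H1 H10_H1)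
    from H1_norm_scaleR[OF op this, of c] show ?thesis by (simp only: scaleR_diff_right)
  qed
  have "(\<lambda>k. H1_norm \<Omega> (c *\<^sub>R \<phi> k - c *\<^sub>R u)) \<longlonglongrightarrow> 0"
    unfolding eq using tendsto_mult_left[OF \<phi>(2), of "\<bar>c\<bar>"] by simp
  moreover have "c *\<^sub>R u \<in> H1 \<Omega>" using u by (intro H1_scaleR H10_H1)
  moreover have "c *\<^sub>R \<phi> k \<in> test_functions \<Omega>" for k using \<phi>(1) by (intro test_functions_scaleR)
  ultimately show ?thesis
    unfolding H10_def by (auto intro!: exI[of _ "\<lambda>k. c *\<^sub>R \<phi> k"])
qed

lemma H10_diff:
  assumes "open \<Omega>" "u \<in> H10 \<Omega>" "v \<in> H10 \<Omega>"
  shows "u - v \<in> H10 \<Omega>"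
  using H10_add[OF assms(1,2) H10_scaleR[OF assms(1,3), of "-1"]] by simp

lemma wgrad_diff:
  assumes op: "open \<Omega>" and u: "u \<in> H10 \<Omega>" and v: "v \<in> H10 \<Omega>"
  shows "AE x in lebesgue_on \<Omega>. wgrad \<Omega> (u - v) x = (wgrad \<Omega> u - wgrad \<Omega> v) x"
proof -
  have "u - v \<in> H1 \<Omega>" by (intro H10_H1 H10_diff assms)
  from wgrad_add[OF op this H10_H1[OF v]]
  show ?thesis by eventually_elim simp
qed

text \<open>
  A functional on \<open>H\<^sub>0\<^sup>1\<close> determines its \<open>L\<^sup>2\<close> representative because \<open>H\<^sub>0\<^sup>1\<close> contains the test
  functions.
\<close>

lemma represents_div_plus_unique:
  assumes op: "open \<Omega>" and "represents_div_plus \<Omega> \<sigma> l w" "represents_div_plus \<Omega> \<sigma> l w'"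
  shows "AE x in lebesgue_on \<Omega>. w x = w' x"
proof -
  have L: "\<Omega> \<in> sets lebesgue" using op by auto
  have w: "w \<in> L2 \<Omega>" "w' \<in> L2 \<Omega>" using assms by (auto simp: represents_div_plus_def)
  have "AE x in lebesgue_on \<Omega>. (w - w') x = 0"
  proof (rule fundamental_lemma_variations[OF op L2_diff[OF w]])
    fix \<phi> assume \<phi>: "\<phi> \<in> test_functions \<Omega>"
    then have "L2_inner \<Omega> w \<phi> = L2_inner \<Omega> w' \<phi>"
      using assms test_function_H10[OF op \<phi>] by (metis represents_div_plus_def)
    then have "L2_inner \<Omega> (w - w') \<phi> = 0"
      using L2_inner_diff_left[OF w test_function_L2[OF L \<phi>]] by simp
    then show "(LINT x|lebesgue_on \<Omega>. (w - w') x * \<phi> x) = 0"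
      by (simp add: L2_inner_def)
  qed
  then show ?thesis by eventually_elim simp
qed

section \<open>The space \<open>U\<close> and the bilinear form\<close>

lemma L2_inner_AE_diff_right:
  assumes "f \<in> L2 \<Omega>" "f1 \<in> L2 \<Omega>" "f2 \<in> L2 \<Omega>" "h \<in> L2 \<Omega>"
    and "AE x in lebesgue_on \<Omega>. f x = (f1 - f2) x"
  shows "L2_inner \<Omega> h f = L2_inner \<Omega> h f1 - L2_inner \<Omega> h f2"
proof -
  have "L2_inner \<Omega> f h = L2_inner \<Omega> (f1 - f2) h"
    by (rule L2_inner_cong_AE[OF assms(1) L2_diff[OF assms(2,3)] assms(4,5)])
  also have "\<dots> = L2_inner \<Omega> f1 h - L2_inner \<Omega> f2 h"
    by (rule L2_inner_diff_left[OF assms(2-4)])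
  finally show ?thesis by (simp only: L2_inner_commute)
qed

lemma L2_inner_AE_diff_left:
  assumes "f \<in> L2 \<Omega>" "f1 \<in> L2 \<Omega>" "f2 \<in> L2 \<Omega>" "h \<in> L2 \<Omega>"
    and "AE x in lebesgue_on \<Omega>. f x = (f1 - f2) x"
  shows "L2_inner \<Omega> f h = L2_inner \<Omega> f1 h - L2_inner \<Omega> f2 h"
  using L2_inner_AE_diff_right[OF assms] by (simp only: L2_inner_commute)

lemma L2_inner_zero_norm:
  assumes "f \<in> L2 \<Omega>" "h \<in> L2 \<Omega>" "L2_norm \<Omega> f = 0"
  shows "L2_inner \<Omega> f h = 0"
  using L2_Cauchy_Schwarz[OF assms(1,2)] assms(3) by simp

lemma wgrad_H10_L2: "v \<in> H10 \<Omega> \<Longrightarrow> wgrad \<Omega> v \<in> L2 \<Omega>"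
  by (rule wgrad_L2[OF H10_H1])

lemma L2_inner_wgrad_add:
  assumes op: "open \<Omega>" and h: "h \<in> L2 \<Omega>" and u: "u \<in> H10 \<Omega>" and v: "v \<in> H10 \<Omega>"
  shows "L2_inner \<Omega> h (wgrad \<Omega> (u + v)) = L2_inner \<Omega> h (wgrad \<Omega> u) + L2_inner \<Omega> h (wgrad \<Omega> v)"
proof -
  have "L2_inner \<Omega> (wgrad \<Omega> (u + v)) h = L2_inner \<Omega> (wgrad \<Omega> u + wgrad \<Omega> v) h"
    by (rule L2_inner_cong_AE[OF wgrad_H10_L2[OF H10_add[OF op u v]]
          L2_add[OF wgrad_H10_L2[OF u] wgrad_H10_L2[OF v]] h wgrad_add[OF op H10_H1[OF u] H10_H1[OF v]]])
  also have "\<dots> = L2_inner \<Omega> (wgrad \<Omega> u) h + L2_inner \<Omega> (wgrad \<Omega> v) h"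
    by (rule L2_inner_add_left[OF wgrad_H10_L2[OF u] wgrad_H10_L2[OF v] h])
  finally show ?thesis by (simp only: L2_inner_commute)
qed

lemma L2_inner_wgrad_scaleR:
  assumes op: "open \<Omega>" and h: "h \<in> L2 \<Omega>" and u: "u \<in> H10 \<Omega>"
  shows "L2_inner \<Omega> h (wgrad \<Omega> (c *\<^sub>R u)) = c * L2_inner \<Omega> h (wgrad \<Omega> u)"
proof -
  have "L2_inner \<Omega> (wgrad \<Omega> (c *\<^sub>R u)) h = L2_inner \<Omega> (c *\<^sub>R wgrad \<Omega> u) h"
    by (rule L2_inner_cong_AE[OF wgrad_H10_L2[OF H10_scaleR[OF op u]]
          L2_scaleR[OF wgrad_H10_L2[OF u]] h wgrad_scaleR[OF op H10_H1[OF u]]])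
  also have "\<dots> = c * L2_inner \<Omega> (wgrad \<Omega> u) h" by (rule L2_inner_scaleR_left)
  finally show ?thesis by (simp only: L2_inner_commute)
qed

lemma Hm1_diff_apply:
  assumes op: "open \<Omega>" and l: "l \<in> Hm1 \<Omega>" and v: "v \<in> H10 \<Omega>" and w: "w \<in> H10 \<Omega>"
  shows "l (v - w) = l v - l w"
proof -
  have "l ((v - w) + w) = l (v - w) + l w"
    using l w H10_diff[OF op v w] unfolding Hm1_def by blast
  then show ?thesis by simp
qed

lemma Hm1_add:
  assumes "l \<in> Hm1 \<Omega>" "m \<in> Hm1 \<Omega>"
  shows "l + m \<in> Hm1 \<Omega>"
proof -
  obtain C D where C: "\<And>v. v \<in> H10 \<Omega> \<Longrightarrow> \<bar>l v\<bar> \<le> C * H1_norm \<Omega> v"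
    and D: "\<And>v. v \<in> H10 \<Omega> \<Longrightarrow> \<bar>m v\<bar> \<le> D * H1_norm \<Omega> v"
    using assms unfolding Hm1_def by blast
  have lin: "k (v + w) = k v + k w" "k (c *\<^sub>R v) = c * k v"
    if "k \<in> Hm1 \<Omega>" "v \<in> H10 \<Omega>" "w \<in> H10 \<Omega>" for k v w c
    using that unfolding Hm1_def by blast+
  have bd: "\<bar>(l + m) v\<bar> \<le> (C + D) * H1_norm \<Omega> v" if "v \<in> H10 \<Omega>" for v
    using C[OF that] D[OF that] by (simp add: distrib_right)
  show ?thesis
    unfolding Hm1_def mem_Collect_eq
  proof (intro conjI ballI allI exI)
    fix v w assume "v \<in> H10 \<Omega>" "w \<in> H10 \<Omega>"
    then show "(l + m) (v + w) = (l + m) v + (l + m) w"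
      using lin(1)[OF assms(1)] lin(1)[OF assms(2)] by simp
  next
    fix c v assume v: "v \<in> H10 \<Omega>"
    show "(l + m) (c *\<^sub>R v) = c * (l + m) v"
      using lin(2)[OF assms(1) v v] lin(2)[OF assms(2) v v] by (simp add: distrib_left)
  qed (rule bd)
qed

lemma Hm1_scaleR:
  assumes "l \<in> Hm1 \<Omega>"
  shows "c *\<^sub>R l \<in> Hm1 \<Omega>"
proof -
  obtain C where C: "\<And>v. v \<in> H10 \<Omega> \<Longrightarrow> \<bar>l v\<bar> \<le> C * H1_norm \<Omega> v"
    using assms unfolding Hm1_def by blast
  have bd: "\<bar>(c *\<^sub>R l) v\<bar> \<le> (\<bar>c\<bar> * C) * H1_norm \<Omega> v" if "v \<in> H10 \<Omega>" for v
    using mult_left_mono[OF C[OF that], of "\<bar>c\<bar>"] by (simp add: scaleR_fun_def abs_mult mult.assoc)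
  show ?thesis
    unfolding Hm1_def mem_Collect_eq
  proof (intro conjI ballI allI exI)
    fix v w assume "v \<in> H10 \<Omega>" "w \<in> H10 \<Omega>"
    then have "l (v + w) = l v + l w" using assms unfolding Hm1_def by blast
    then show "(c *\<^sub>R l) (v + w) = (c *\<^sub>R l) v + (c *\<^sub>R l) w"
      by (simp add: scaleR_fun_def distrib_left)
  next
    fix d v assume "v \<in> H10 \<Omega>"
    then have "l (d *\<^sub>R v) = d * l v" using assms unfolding Hm1_def by blast
    then show "(c *\<^sub>R l) (d *\<^sub>R v) = d * (c *\<^sub>R l) v"
      by (simp add: scaleR_fun_def[of c])
  qed (rule bd)
qed

text \<open>
  The multiplier for which \<open>div \<tau>\<close> plus the multiplier is a prescribed \<open>L\<^sup>2\<close> function \<open>z\<close>.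
\<close>

lemma L2_pair_Hm1:
  assumes op: "open \<Omega>" and z: "z \<in> L2 \<Omega>" and \<tau>: "\<tau> \<in> L2 \<Omega>"
  shows "(\<lambda>v. L2_inner \<Omega> z v - gdiv \<Omega> \<tau> v) \<in> Hm1 \<Omega>"
  unfolding Hm1_def mem_Collect_eq
proof (intro conjI ballI allI)
  fix v w assume v: "v \<in> H10 \<Omega>" and w: "w \<in> H10 \<Omega>"
  show "L2_inner \<Omega> z (v + w) - gdiv \<Omega> \<tau> (v + w) =
      L2_inner \<Omega> z v - gdiv \<Omega> \<tau> v + (L2_inner \<Omega> z w - gdiv \<Omega> \<tau> w)"
    unfolding gdiv_def L2_inner_wgrad_add[OF op \<tau> v w] L2_inner_add_right[OF H10_L2[OF v] H10_L2[OF w] z]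
    by simp
next
  fix c v assume v: "v \<in> H10 \<Omega>"
  show "L2_inner \<Omega> z (c *\<^sub>R v) - gdiv \<Omega> \<tau> (c *\<^sub>R v) = c * (L2_inner \<Omega> z v - gdiv \<Omega> \<tau> v)"
    unfolding gdiv_def L2_inner_wgrad_scaleR[OF op \<tau> v] L2_inner_scaleR_right
    by (simp add: algebra_simps)
next
  have "\<bar>L2_inner \<Omega> z v - gdiv \<Omega> \<tau> v\<bar> \<le> (L2_norm \<Omega> z + L2_norm \<Omega> \<tau>) * H1_norm \<Omega> v"
    if v: "v \<in> H10 \<Omega>" for v
  proof -
    have "\<bar>L2_inner \<Omega> z v\<bar> \<le> L2_norm \<Omega> z * H1_norm \<Omega> v"
      using L2_Cauchy_Schwarz[OF z H10_L2[OF v]]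
        mult_left_mono[OF L2_norm_le_H1_norm[of \<Omega> v] L2_norm_nonneg[of \<Omega> z]] by linarith
    moreover have "\<bar>L2_inner \<Omega> \<tau> (wgrad \<Omega> v)\<bar> \<le> L2_norm \<Omega> \<tau> * H1_norm \<Omega> v"
      using L2_Cauchy_Schwarz[OF \<tau> wgrad_H10_L2[OF v]]
        mult_left_mono[OF L2_norm_wgrad_le_H1_norm[of \<Omega> v] L2_norm_nonneg[of \<Omega> \<tau>]] by linarith
    ultimately show ?thesis unfolding gdiv_def distrib_right by linarith
  qed
  then show "\<exists>C. \<forall>v\<in>H10 \<Omega>. \<bar>L2_inner \<Omega> z v - gdiv \<Omega> \<tau> v\<bar> \<le> C * H1_norm \<Omega> v" by blast
qed

lemma represents_div_plus_add:
  assumes "\<sigma> \<in> L2 \<Omega>" "\<tau> \<in> L2 \<Omega>"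
    and w: "represents_div_plus \<Omega> \<sigma> l w" and z: "represents_div_plus \<Omega> \<tau> m z"
  shows "represents_div_plus \<Omega> (\<sigma> + \<tau>) (l + m) (w + z)"
  unfolding represents_div_plus_def
proof (intro conjI ballI)
  have L: "w \<in> L2 \<Omega>" "z \<in> L2 \<Omega>" using w z by (auto simp: represents_div_plus_def)
  then show "w + z \<in> L2 \<Omega>" by (rule L2_add)
  fix v assume v: "v \<in> H10 \<Omega>"
  have "gdiv \<Omega> \<sigma> v + l v = L2_inner \<Omega> w v" "gdiv \<Omega> \<tau> v + m v = L2_inner \<Omega> z v"
    using w z v by (auto simp: represents_div_plus_def)
  moreover have "gdiv \<Omega> (\<sigma> + \<tau>) v = gdiv \<Omega> \<sigma> v + gdiv \<Omega> \<tau> v"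
    unfolding gdiv_def L2_inner_add_left[OF assms(1,2) wgrad_H10_L2[OF v]] by simp
  ultimately show "gdiv \<Omega> (\<sigma> + \<tau>) v + (l + m) v = L2_inner \<Omega> (w + z) v"
    unfolding L2_inner_add_left[OF L H10_L2[OF v]] by simp
qed

lemma represents_div_plus_scaleR:
  assumes w: "represents_div_plus \<Omega> \<sigma> l w"
  shows "represents_div_plus \<Omega> (c *\<^sub>R \<sigma>) (c *\<^sub>R l) (c *\<^sub>R w)"
  unfolding represents_div_plus_def
proof (intro conjI ballI)
  show "c *\<^sub>R w \<in> L2 \<Omega>" using w by (intro L2_scaleR) (simp add: represents_div_plus_def)
  fix v assume v: "v \<in> H10 \<Omega>"
  have "c * (gdiv \<Omega> \<sigma> v + l v) = c * L2_inner \<Omega> w v"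
    using w v by (simp add: represents_div_plus_def)
  then show "gdiv \<Omega> (c *\<^sub>R \<sigma>) v + (c *\<^sub>R l) v = L2_inner \<Omega> (c *\<^sub>R w) v"
    unfolding gdiv_def L2_inner_scaleR_left by (simp add: scaleR_fun_def algebra_simps)
qed

lemma U_D:
  assumes "(u, \<sigma>, l) \<in> U \<Omega>"
  shows "u \<in> H10 \<Omega>" "\<sigma> \<in> L2 \<Omega>" "l \<in> Hm1 \<Omega>"
    and U_represents: "represents_div_plus \<Omega> \<sigma> l (div_plus \<Omega> \<sigma> l)"
    and U_div_plus_L2: "div_plus \<Omega> \<sigma> l \<in> L2 \<Omega>"
    and U_residual_L2: "wgrad \<Omega> u - \<sigma> \<in> L2 \<Omega>"
proof -
  show u: "u \<in> H10 \<Omega>" and s: "\<sigma> \<in> L2 \<Omega>" and "l \<in> Hm1 \<Omega>" using assms by (auto simp: U_def)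
  have "\<exists>w. represents_div_plus \<Omega> \<sigma> l w" using assms by (auto simp: U_def)
  then show "represents_div_plus \<Omega> \<sigma> l (div_plus \<Omega> \<sigma> l)" unfolding div_plus_def by (rule someI_ex)
  then show "div_plus \<Omega> \<sigma> l \<in> L2 \<Omega>" by (simp add: represents_div_plus_def)
  show "wgrad \<Omega> u - \<sigma> \<in> L2 \<Omega>" by (rule L2_diff[OF wgrad_H10_L2[OF u] s])
qed

lemma represents_div_plus_diff:
  assumes "(u, \<sigma>, l) \<in> U \<Omega>" "(v, \<tau>, m) \<in> U \<Omega>"
  shows "represents_div_plus \<Omega> (\<sigma> - \<tau>) (l - m) (div_plus \<Omega> \<sigma> l - div_plus \<Omega> \<tau> m)"
  using represents_div_plus_add[OF U_D(2)[OF assms(1)] L2_scaleR[OF U_D(2)[OF assms(2)]]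
      U_represents[OF assms(1)] represents_div_plus_scaleR[OF U_represents[OF assms(2)]], of "-1"]
  by simp

lemma U_diff:
  assumes op: "open \<Omega>" and p: "(u, \<sigma>, l) \<in> U \<Omega>" and q: "(v, \<tau>, m) \<in> U \<Omega>"
  shows "(u - v, \<sigma> - \<tau>, l - m) \<in> U \<Omega>"
proof -
  have "l - m \<in> Hm1 \<Omega>"
    using Hm1_add[OF U_D(3)[OF p] Hm1_scaleR[OF U_D(3)[OF q], of "-1"]] by simp
  then show ?thesis
    using H10_diff[OF op U_D(1)[OF p] U_D(1)[OF q]] L2_diff[OF U_D(2)[OF p] U_D(2)[OF q]]
      represents_div_plus_diff[OF p q]
    unfolding U_def by blast
qed

lemma div_plus_diff:
  assumes op: "open \<Omega>" and p: "(u, \<sigma>, l) \<in> U \<Omega>" and q: "(v, \<tau>, m) \<in> U \<Omega>"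
  shows "AE x in lebesgue_on \<Omega>. div_plus \<Omega> (\<sigma> - \<tau>) (l - m) x = (div_plus \<Omega> \<sigma> l - div_plus \<Omega> \<tau> m) x"
  by (rule represents_div_plus_unique[OF op U_represents[OF U_diff[OF op p q]]
        represents_div_plus_diff[OF p q]])

lemma residual_diff:
  assumes op: "open \<Omega>" and p: "(u, \<sigma>, l) \<in> U \<Omega>" and q: "(v, \<tau>, m) \<in> U \<Omega>"
  shows "AE x in lebesgue_on \<Omega>.
    (wgrad \<Omega> (u - v) - (\<sigma> - \<tau>)) x = ((wgrad \<Omega> u - \<sigma>) - (wgrad \<Omega> v - \<tau>)) x"
  using wgrad_diff[OF op U_D(1)[OF p] U_D(1)[OF q]] by eventually_elim simp

lemma b_form_diff_right:
  assumes op: "open \<Omega>" and p: "p \<in> U \<Omega>" and q: "q \<in> U \<Omega>" and r: "r \<in> U \<Omega>"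
  shows "b_form \<Omega> \<beta> p (q - r) = b_form \<Omega> \<beta> p q - b_form \<Omega> \<beta> p r"
proof -
  obtain u \<sigma> l where p': "p = (u, \<sigma>, l)" by (cases p)
  obtain v \<tau> m where q': "q = (v, \<tau>, m)" by (cases q)
  obtain w \<rho> n where r': "r = (w, \<rho>, n)" by (cases r)
  note P = p[unfolded p'] and Q = q[unfolded q'] and R = r[unfolded r']
  note D = U_diff[OF op Q R]
  show ?thesis
    unfolding b_form_def p' q' r' diff_Pair prod.case
      L2_inner_AE_diff_right[OF U_div_plus_L2[OF D] U_div_plus_L2[OF Q] U_div_plus_L2[OF R]
        U_div_plus_L2[OF P] div_plus_diff[OF op Q R]]
      L2_inner_AE_diff_right[OF U_residual_L2[OF D] U_residual_L2[OF Q] U_residual_L2[OF R]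
        U_residual_L2[OF P] residual_diff[OF op Q R]]
      Hm1_diff_apply[OF op U_D(3)[OF P] U_D(1)[OF Q] U_D(1)[OF R]]
    by (simp add: algebra_simps)
qed

lemma b_form_diff_left:
  assumes op: "open \<Omega>" and p: "p \<in> U \<Omega>" and q: "q \<in> U \<Omega>" and r: "r \<in> U \<Omega>"
  shows "b_form \<Omega> \<beta> (q - r) p = b_form \<Omega> \<beta> q p - b_form \<Omega> \<beta> r p"
proof -
  obtain u \<sigma> l where p': "p = (u, \<sigma>, l)" by (cases p)
  obtain v \<tau> m where q': "q = (v, \<tau>, m)" by (cases q)
  obtain w \<rho> n where r': "r = (w, \<rho>, n)" by (cases r)
  note P = p[unfolded p'] and Q = q[unfolded q'] and R = r[unfolded r']
  note D = U_diff[OF op Q R]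
  show ?thesis
    unfolding b_form_def p' q' r' diff_Pair prod.case
      L2_inner_AE_diff_left[OF U_div_plus_L2[OF D] U_div_plus_L2[OF Q] U_div_plus_L2[OF R]
        U_div_plus_L2[OF P] div_plus_diff[OF op Q R]]
      L2_inner_AE_diff_left[OF U_residual_L2[OF D] U_residual_L2[OF Q] U_residual_L2[OF R]
        U_residual_L2[OF P] residual_diff[OF op Q R]]
    by (simp add: algebra_simps)
qed

text \<open>
  Makes the duality pairing accessible to estimates: the defining property of \<open>div_plus\<close> turns it into two
  \<open>L\<^sup>2\<close> inner products of quantities controlled by \<open>U_norm\<close>.
\<close>

lemma U_pairing:
  assumes "(u, \<sigma>, l) \<in> U \<Omega>" "v \<in> H10 \<Omega>"
  shows "l v = L2_inner \<Omega> (div_plus \<Omega> \<sigma> l) v + L2_inner \<Omega> \<sigma> (wgrad \<Omega> v)"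
proof -
  have "gdiv \<Omega> \<sigma> v + l v = L2_inner \<Omega> (div_plus \<Omega> \<sigma> l) v"
    using U_represents[OF assms(1)] assms(2) by (simp add: represents_div_plus_def)
  then show ?thesis by (simp add: gdiv_def)
qed

lemma U_norm_nonneg: "0 \<le> U_norm \<Omega> p"
  by (cases p) (simp add: U_norm_def)

lemma U_norm_components:
  "L2_norm \<Omega> (wgrad \<Omega> u) \<le> U_norm \<Omega> (u, \<sigma>, l)"
  "L2_norm \<Omega> \<sigma> \<le> U_norm \<Omega> (u, \<sigma>, l)"
  "L2_norm \<Omega> (div_plus \<Omega> \<sigma> l) \<le> U_norm \<Omega> (u, \<sigma>, l)"
  unfolding U_norm_def prod.case by (rule real_le_rsqrt, simp)+

lemma U_norm_sq:
  "(U_norm \<Omega> (u, \<sigma>, l))\<^sup>2 =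
    (L2_norm \<Omega> (wgrad \<Omega> u))\<^sup>2 + (L2_norm \<Omega> \<sigma>)\<^sup>2 + (L2_norm \<Omega> (div_plus \<Omega> \<sigma> l))\<^sup>2"
  by (simp add: U_norm_def)

text \<open>
  With \<open>a\<close>, \<open>s\<close>, \<open>d\<close> the norms of \<open>\<nabla>u\<close>, \<open>\<sigma>\<close> and \<open>div \<sigma> + l\<close>, the form is at least
  \<open>\<beta> d\<^sup>2 + a\<^sup>2 + s\<^sup>2 - s a - C d a\<close>.  Young's inequality in the forms
  \<open>C d a \<le> C\<^sup>2 d\<^sup>2 + a\<^sup>2/4\<close> and \<open>s a \<le> a\<^sup>2/2 + s\<^sup>2/2\<close> leaves \<open>a\<^sup>2/4 + s\<^sup>2/2 + d\<^sup>2\<close>.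
\<close>

lemma b_form_coercive:
  assumes fr: "friedrichs_constant \<Omega> C" and \<beta>: "\<beta> \<ge> 1 + C\<^sup>2" and p: "p \<in> U \<Omega>"
  shows "(U_norm \<Omega> p)\<^sup>2 / 4 \<le> b_form \<Omega> \<beta> p p"
proof -
  obtain u \<sigma> l where p': "p = (u, \<sigma>, l)" by (cases p)
  note P = p[unfolded p']
  define a s d where "a = L2_norm \<Omega> (wgrad \<Omega> u)" and "s = L2_norm \<Omega> \<sigma>"
    and "d = L2_norm \<Omega> (div_plus \<Omega> \<sigma> l)"
  have nn: "0 \<le> a" "0 \<le> s" "0 \<le> d" by (simp_all add: a_def s_def d_def L2_norm_nonneg)
  define x y where "x = L2_inner \<Omega> \<sigma> (wgrad \<Omega> u)" and "y = L2_inner \<Omega> (div_plus \<Omega> \<sigma> l) u"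
  note g = wgrad_H10_L2[OF U_D(1)[OF P]] and S = U_D(2)[OF P]
  have res: "L2_inner \<Omega> (wgrad \<Omega> u - \<sigma>) (wgrad \<Omega> u - \<sigma>) = a\<^sup>2 - 2 * x + s\<^sup>2"
    unfolding L2_inner_diff_left[OF g S U_residual_L2[OF P]] L2_inner_diff_right[OF g S g]
      L2_inner_diff_right[OF g S S] a_def s_def x_def L2_norm_sq L2_inner_commute[of \<Omega> "wgrad \<Omega> u" \<sigma>]
    by simp
  have b: "b_form \<Omega> \<beta> p p = \<beta> * d\<^sup>2 + a\<^sup>2 + s\<^sup>2 - x + y"
    unfolding p' b_form_def prod.case res U_pairing[OF P U_D(1)[OF P]] d_def L2_norm_sq
    by (simp add: x_def y_def)
  have x: "\<bar>x\<bar> \<le> s * a" unfolding x_def s_def a_def by (rule L2_Cauchy_Schwarz[OF S g])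
  have "\<bar>y\<bar> \<le> d * L2_norm \<Omega> u"
    unfolding y_def d_def by (rule L2_Cauchy_Schwarz[OF U_div_plus_L2[OF P] H10_L2[OF U_D(1)[OF P]]])
  also have "\<dots> \<le> d * (C * a)"
    using fr U_D(1)[OF P] nn(3) by (intro mult_left_mono) (auto simp: friedrichs_constant_def a_def)
  finally have y: "\<bar>y\<bar> \<le> d * (C * a)" .
  have "0 \<le> (C * d - a / 2)\<^sup>2" "0 \<le> (a - s)\<^sup>2" by simp_all
  then have "d * (C * a) \<le> C\<^sup>2 * d\<^sup>2 + a\<^sup>2 / 4" "s * a \<le> a\<^sup>2 / 2 + s\<^sup>2 / 2"
    by (simp_all add: power2_eq_square field_simps)
  moreover have "(1 + C\<^sup>2) * d\<^sup>2 \<le> \<beta> * d\<^sup>2" using \<beta> by (intro mult_right_mono) auto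
  ultimately have "a\<^sup>2 / 4 + s\<^sup>2 / 2 + d\<^sup>2 \<le> b_form \<Omega> \<beta> p p"
    using x y unfolding b distrib_right by linarith
  moreover have "(U_norm \<Omega> p)\<^sup>2 = a\<^sup>2 + s\<^sup>2 + d\<^sup>2" by (simp add: p' U_norm_sq a_def s_def d_def)
  ultimately show ?thesis using zero_le_power2[of s] zero_le_power2[of d] by linarith
qed

text \<open>
  The constant collects \<open>\<beta>\<close> from the least-squares term, \<open>4\<close> from the residuals \<open>\<nabla>u - \<sigma>\<close>, whose
  norms are at most twice \<open>U_norm\<close>, and \<open>C + 1\<close> from the pairing.
\<close>

lemma b_form_bounded:
  assumes fr: "friedrichs_constant \<Omega> C" and \<beta>: "0 \<le> \<beta>" and p: "p \<in> U \<Omega>" and q: "q \<in> U \<Omega>"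
  shows "\<bar>b_form \<Omega> \<beta> p q\<bar> \<le> (\<beta> + 5 + C) * (U_norm \<Omega> p * U_norm \<Omega> q)"
proof -
  obtain u \<sigma> l where p': "p = (u, \<sigma>, l)" by (cases p)
  obtain v \<tau> m where q': "q = (v, \<tau>, m)" by (cases q)
  note P = p[unfolded p'] and Q = q[unfolded q']
  define N M where "N = U_norm \<Omega> p" and "M = U_norm \<Omega> q"
  have nn: "0 \<le> N" "0 \<le> M" by (simp_all add: N_def M_def U_norm_nonneg)
  have C: "0 \<le> C" using fr by (simp add: friedrichs_constant_def)
  have res: "L2_norm \<Omega> (wgrad \<Omega> u - \<sigma>) \<le> 2 * U_norm \<Omega> (u, \<sigma>, l)"
    if P: "(u, \<sigma>, l) \<in> U \<Omega>" for u \<sigma> l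
  proof -
    have "L2_norm \<Omega> (wgrad \<Omega> u + (-1) *\<^sub>R \<sigma>) \<le> L2_norm \<Omega> (wgrad \<Omega> u) + L2_norm \<Omega> ((-1) *\<^sub>R \<sigma>)"
      by (rule L2_norm_triangle[OF wgrad_H10_L2[OF U_D(1)[OF P]] L2_scaleR[OF U_D(2)[OF P]]])
    then have "L2_norm \<Omega> (wgrad \<Omega> u - \<sigma>) \<le> L2_norm \<Omega> (wgrad \<Omega> u) + L2_norm \<Omega> \<sigma>"
      unfolding L2_norm_scaleR by simp
    then show ?thesis using U_norm_components(1)[of \<Omega> u \<sigma> l]
        U_norm_components(2)[of \<Omega> \<sigma> u l] by linarith
  qed
  have 1: "\<bar>L2_inner \<Omega> (div_plus \<Omega> \<sigma> l) (div_plus \<Omega> \<tau> m)\<bar> \<le> N * M"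
    unfolding N_def M_def p' q'
    by (rule order_trans[OF L2_Cauchy_Schwarz[OF U_div_plus_L2[OF P] U_div_plus_L2[OF Q]]
          mult_mono'[OF U_norm_components(3) U_norm_components(3) L2_norm_nonneg L2_norm_nonneg]])
  have 2: "\<bar>L2_inner \<Omega> (wgrad \<Omega> u - \<sigma>) (wgrad \<Omega> v - \<tau>)\<bar> \<le> (2 * N) * (2 * M)"
    unfolding N_def M_def p' q'
    by (rule order_trans[OF L2_Cauchy_Schwarz[OF U_residual_L2[OF P] U_residual_L2[OF Q]]
          mult_mono'[OF res[OF P] res[OF Q] L2_norm_nonneg L2_norm_nonneg]])
  have "L2_norm \<Omega> v \<le> C * L2_norm \<Omega> (wgrad \<Omega> v)"
    using fr U_D(1)[OF Q] by (simp add: friedrichs_constant_def)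
  also have "\<dots> \<le> C * M"
    unfolding M_def q' by (rule mult_left_mono[OF U_norm_components(1) C])
  finally have v: "L2_norm \<Omega> v \<le> C * M" .
  have 3: "\<bar>L2_inner \<Omega> (div_plus \<Omega> \<sigma> l) v\<bar> \<le> N * (C * M)"
    using v unfolding N_def p'
    by (intro order_trans[OF L2_Cauchy_Schwarz[OF U_div_plus_L2[OF P] H10_L2[OF U_D(1)[OF Q]]]
          mult_mono'[OF U_norm_components(3) _ L2_norm_nonneg L2_norm_nonneg]])
  have 4: "\<bar>L2_inner \<Omega> \<sigma> (wgrad \<Omega> v)\<bar> \<le> N * M"
    unfolding N_def M_def p' q'
    by (rule order_trans[OF L2_Cauchy_Schwarz[OF U_D(2)[OF P] wgrad_H10_L2[OF U_D(1)[OF Q]]]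
          mult_mono'[OF U_norm_components(2) U_norm_components(1) L2_norm_nonneg L2_norm_nonneg]])
  have "\<bar>\<beta> * L2_inner \<Omega> (div_plus \<Omega> \<sigma> l) (div_plus \<Omega> \<tau> m)\<bar> \<le> \<beta> * (N * M)"
    using mult_left_mono[OF 1 \<beta>] \<beta> by (simp add: abs_mult)
  moreover have "b_form \<Omega> \<beta> p q = \<beta> * L2_inner \<Omega> (div_plus \<Omega> \<sigma> l) (div_plus \<Omega> \<tau> m)
      + L2_inner \<Omega> (wgrad \<Omega> u - \<sigma>) (wgrad \<Omega> v - \<tau>)
      + (L2_inner \<Omega> (div_plus \<Omega> \<sigma> l) v + L2_inner \<Omega> \<sigma> (wgrad \<Omega> v))"
    unfolding p' q' b_form_def prod.case U_pairing[OF P U_D(1)[OF Q]] by simp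
  ultimately have "\<bar>b_form \<Omega> \<beta> p q\<bar> \<le> \<beta> * (N * M) + (2 * N) * (2 * M) + (N * (C * M) + N * M)"
    using 2 3 4 by linarith
  also have "\<dots> = (\<beta> + 5 + C) * (N * M)" by (simp add: algebra_simps)
  finally show ?thesis by (simp only: N_def M_def)
qed

section \<open>The variational inequalities\<close>

text \<open>
  Directions that leave the first component unchanged, with flux and \<open>L\<^sup>2\<close> part prescribed
  independently: translation by them preserves \<open>K0\<close>.
\<close>

lemma U_zero_primal_exists:
  assumes op: "open \<Omega>" and z: "z \<in> L2 \<Omega>" and \<tau>: "\<tau> \<in> L2 \<Omega>"
  obtains m where "(0, \<tau>, m) \<in> U \<Omega>" "represents_div_plus \<Omega> \<tau> m z"
proof
  let ?m = "\<lambda>v. L2_inner \<Omega> z v - gdiv \<Omega> \<tau> v"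
  show rep: "represents_div_plus \<Omega> \<tau> ?m z" using z by (simp add: represents_div_plus_def)
  have "0 \<in> test_functions \<Omega>"
    by (auto simp: test_functions_def smooth_def zero_fun_def Ck_const)
  then have "0 \<in> H10 \<Omega>" by (rule test_function_H10[OF op])
  then show "(0, \<tau>, ?m) \<in> U \<Omega>"
    using L2_pair_Hm1[OF op z \<tau>] \<tau> rep unfolding U_def by blast
qed

text \<open>
  Both components of the first-order residual vanish: the perturbation chosen below is
  minus the residual itself, and the variational inequality tested with it says that the weighted
  sum of the squared residual norms is nonpositive.
\<close>

lemma VI_residual_eq_multiplier:
  assumes op: "open \<Omega>" and \<beta>: "0 < \<beta>" and f: "f \<in> L2 \<Omega>"
    and sol: "solves_VI \<Omega> \<beta> f (K0 \<Omega> g) (u, \<sigma>, l)" and q: "(v, \<tau>, m) \<in> U \<Omega>"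
  shows "b_form \<Omega> \<beta> (u, \<sigma>, l) (v, \<tau>, m) - G_form \<Omega> \<beta> f (v, \<tau>, m) = l v"
proof -
  have pK: "(u, \<sigma>, l) \<in> K0 \<Omega> g" using sol by (simp add: solves_VI_def)
  then have P: "(u, \<sigma>, l) \<in> U \<Omega>" by (simp add: K0_def)
  define E r where "E = wgrad \<Omega> u - \<sigma>" and "r = div_plus \<Omega> \<sigma> l + f"
  have E: "E \<in> L2 \<Omega>" unfolding E_def by (rule U_residual_L2[OF P])
  have r: "r \<in> L2 \<Omega>" unfolding r_def by (rule L2_add[OF U_div_plus_L2[OF P] f])
  have val: "b_form \<Omega> \<beta> (u, \<sigma>, l) (v, \<tau>, m) - G_form \<Omega> \<beta> f (v, \<tau>, m)
      = \<beta> * L2_inner \<Omega> r (div_plus \<Omega> \<tau> m) + L2_inner \<Omega> E (wgrad \<Omega> v - \<tau>) + l v"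
    if "(v, \<tau>, m) \<in> U \<Omega>" for v \<tau> m
    unfolding r_def L2_inner_add_left[OF U_div_plus_L2[OF P] f U_div_plus_L2[OF that]]
      b_form_def G_form_def prod.case E_def by (simp add: algebra_simps)
  \<comment> \<open>Flux \<open>E\<close> and \<open>L\<^sup>2\<close> part \<open>-r\<close> make both residual terms nonpositive at once.\<close>
  obtain n where n: "(0, E, n) \<in> U \<Omega>" "represents_div_plus \<Omega> E n ((-1) *\<^sub>R r)"
    using U_zero_primal_exists[OF op L2_scaleR[OF r] E] by blast
  have "(u, \<sigma> + E, l + n) \<in> U \<Omega>"
    using U_D(1)[OF P] L2_add[OF U_D(2)[OF P] E] Hm1_add[OF U_D(3)[OF P] U_D(3)[OF n(1)]]
      represents_div_plus_add[OF U_D(2)[OF P] E U_represents[OF P] n(2)]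
    unfolding U_def by blast
  then have "(u, \<sigma> + E, l + n) \<in> K0 \<Omega> g" using pK by (simp add: K0_def)
  then have "G_form \<Omega> \<beta> f ((u, \<sigma> + E, l + n) - (u, \<sigma>, l))
      \<le> b_form \<Omega> \<beta> (u, \<sigma>, l) ((u, \<sigma> + E, l + n) - (u, \<sigma>, l))"
    using sol unfolding solves_VI_def by blast
  then have "0 \<le> b_form \<Omega> \<beta> (u, \<sigma>, l) (0, E, n) - G_form \<Omega> \<beta> f (0, E, n)"
    by simp
  also have "\<dots> = - (\<beta> * (L2_norm \<Omega> r)\<^sup>2 + (L2_norm \<Omega> E)\<^sup>2)"
  proof -
    have z0: "0 \<in> H10 \<Omega>" by (rule U_D(1)[OF n(1)])
    have "l 0 = 0" using Hm1_diff_apply[OF op U_D(3)[OF P] z0 z0] by simp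
    moreover have "L2_inner \<Omega> r (div_plus \<Omega> E n) = - (L2_norm \<Omega> r)\<^sup>2"
      using L2_inner_cong_AE[OF U_div_plus_L2[OF n(1)] L2_scaleR[OF r] r
          represents_div_plus_unique[OF op U_represents[OF n(1)] n(2)]]
      unfolding L2_inner_scaleR_left L2_norm_sq L2_inner_commute[of \<Omega> "div_plus \<Omega> E n" r] by simp
    moreover have "L2_inner \<Omega> E (wgrad \<Omega> 0 - E) = - (L2_norm \<Omega> E)\<^sup>2"
      using L2_inner_wgrad_scaleR[OF op E z0, of 0]
      unfolding L2_inner_diff_right[OF wgrad_H10_L2[OF z0] E E] L2_norm_sq by simp
    ultimately show ?thesis unfolding val[OF n(1)] by simp
  qed
  finally have "\<beta> * (L2_norm \<Omega> r)\<^sup>2 + (L2_norm \<Omega> E)\<^sup>2 \<le> 0" by simp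
  moreover have "0 \<le> \<beta> * (L2_norm \<Omega> r)\<^sup>2" using \<beta> by simp
  ultimately have "\<beta> * (L2_norm \<Omega> r)\<^sup>2 = 0" "(L2_norm \<Omega> E)\<^sup>2 = 0"
    using zero_le_power2[of "L2_norm \<Omega> E"] by linarith+
  then have z: "L2_norm \<Omega> r = 0" "L2_norm \<Omega> E = 0" using \<beta> by auto
  show ?thesis
    unfolding val[OF q] L2_inner_zero_norm[OF r U_div_plus_L2[OF q] z(1)]
      L2_inner_zero_norm[OF E U_residual_L2[OF q] z(2)] by simp
qed

text \<open>
  With \<open>B\<close> the continuity constant, \<open>N\<^sup>2/4 \<le> B N M + X\<close> for the error \<open>N\<close>, the approximation
  error \<open>M\<close> and the sum \<open>X\<close> of the two pairings.  Absorbing \<open>B N M \<le> N\<^sup>2/8 + 2 B\<^sup>2 M\<^sup>2\<close> gives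
  \<open>N\<^sup>2 \<le> 16 B\<^sup>2 M\<^sup>2 + 8 X\<close>, and \<open>B \<ge> 5\<close> allows the common factor \<open>16 B\<^sup>2\<close>.
\<close>

lemma VI_error_bound:
  assumes op: "open \<Omega>" and fr: "friedrichs_constant \<Omega> C" and \<beta>: "\<beta> \<ge> 1 + C\<^sup>2"
    and f: "f \<in> L2 \<Omega>"
    and sol: "solves_VI \<Omega> \<beta> f (K0 \<Omega> g) (u, \<sigma>, l)"
    and sub: "K_h \<subseteq> U \<Omega>"
    and sol_h: "solves_VI \<Omega> \<beta> f K_h (u_h, \<sigma>_h, l_h)"
    and v_h: "(v_h, \<tau>_h, m_h) \<in> K_h" and v: "(v, \<tau>, m) \<in> K0 \<Omega> g"
  shows "(U_norm \<Omega> ((u, \<sigma>, l) - (u_h, \<sigma>_h, l_h)))\<^sup>2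
    \<le> 16 * (\<beta> + 5 + C)\<^sup>2 * ((U_norm \<Omega> ((u, \<sigma>, l) - (v_h, \<tau>_h, m_h)))\<^sup>2 + \<bar>l (v_h - u)\<bar> + \<bar>l (v - u_h)\<bar>)"
proof -
  define p p_h q_h where "p = (u, \<sigma>, l)" and "p_h = (u_h, \<sigma>_h, l_h)" and "q_h = (v_h, \<tau>_h, m_h)"
  have \<beta>0: "0 < \<beta>" using \<beta> zero_le_power2[of C] by linarith
  have C: "0 < C" using fr by (simp add: friedrichs_constant_def)
  have P: "p \<in> U \<Omega>" using sol by (simp add: solves_VI_def K0_def p_def)
  have PH: "p_h \<in> U \<Omega>" using sol_h sub by (auto simp: solves_VI_def p_h_def)
  have QH: "q_h \<in> U \<Omega>" using v_h sub by (auto simp: q_h_def)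
  have V: "(v, \<tau>, m) \<in> U \<Omega>" using v by (simp add: K0_def)
  have e: "p - p_h \<in> U \<Omega>" and d: "p - q_h \<in> U \<Omega>" and s: "q_h - p_h \<in> U \<Omega>"
    using U_diff[OF op P[unfolded p_def] PH[unfolded p_h_def]]
      U_diff[OF op P[unfolded p_def] QH[unfolded q_h_def]]
      U_diff[OF op QH[unfolded q_h_def] PH[unfolded p_h_def]]
    by (simp_all add: p_def p_h_def q_h_def)
  note uH = U_D(1)[OF P[unfolded p_def]] and uhH = U_D(1)[OF PH[unfolded p_h_def]]
    and vhH = U_D(1)[OF QH[unfolded q_h_def]] and vH = U_D(1)[OF V]
  note lin = Hm1_diff_apply[OF op U_D(3)[OF P[unfolded p_def]]]
  have "b_form \<Omega> \<beta> p (q_h - p_h) - G_form \<Omega> \<beta> f (q_h - p_h) = l (v_h - u_h)"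
    using VI_residual_eq_multiplier[OF op \<beta>0 f sol] s by (simp add: p_def q_h_def p_h_def)
  moreover have "G_form \<Omega> \<beta> f (q_h - p_h) \<le> b_form \<Omega> \<beta> p_h (q_h - p_h)"
    using sol_h v_h unfolding solves_VI_def q_h_def p_h_def by blast
  ultimately have h: "b_form \<Omega> \<beta> (p - p_h) (q_h - p_h) \<le> l (v_h - u_h)"
    unfolding b_form_diff_left[OF op s P PH] by linarith
  have "G_form \<Omega> \<beta> f ((v, \<tau>, m) - p) \<le> b_form \<Omega> \<beta> p ((v, \<tau>, m) - p)"
    using sol v unfolding solves_VI_def p_def by blast
  moreover have "b_form \<Omega> \<beta> p ((v, \<tau>, m) - p) - G_form \<Omega> \<beta> f ((v, \<tau>, m) - p) = l (v - u)"
    using VI_residual_eq_multiplier[OF op \<beta>0 f sol U_diff[OF op V P[unfolded p_def]]]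
    by (simp add: p_def)
  \<comment> \<open>The variational inequality is a sign condition on the multiplier, its residual.\<close>
  ultimately have "0 \<le> l (v - u)" by linarith
  then have split: "l (v_h - u_h) \<le> \<bar>l (v_h - u)\<bar> + \<bar>l (v - u_h)\<bar>"
    unfolding lin[OF vhH uhH] lin[OF vhH uH] lin[OF vH uhH] lin[OF vH uH] by linarith
  define N M B where "N = U_norm \<Omega> (p - p_h)" and "M = U_norm \<Omega> (p - q_h)" and "B = \<beta> + 5 + C"
  have B: "5 \<le> B" using \<beta>0 C by (simp add: B_def)
  have "(p - p_h) - (q_h - p_h) = p - q_h" by (simp add: p_def p_h_def q_h_def)
  then have dec: "b_form \<Omega> \<beta> (p - p_h) (p - q_h)
      = b_form \<Omega> \<beta> (p - p_h) (p - p_h) - b_form \<Omega> \<beta> (p - p_h) (q_h - p_h)"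
    using b_form_diff_right[OF op e e s, of \<beta>] by simp
  have "N\<^sup>2 / 4 \<le> b_form \<Omega> \<beta> (p - p_h) (p - p_h)"
    unfolding N_def by (rule b_form_coercive[OF fr \<beta> e])
  moreover have "b_form \<Omega> \<beta> (p - p_h) (p - q_h) \<le> B * (N * M)"
    unfolding N_def M_def B_def
    by (rule abs_le_D1[OF b_form_bounded[OF fr less_imp_le[OF \<beta>0] e d]])
  moreover have "B * (N * M) \<le> N\<^sup>2 / 8 + 2 * (B\<^sup>2 * M\<^sup>2)"
    using zero_le_power2[of "N - 4 * (B * M)"] by (simp add: power2_eq_square field_simps)
  ultimately have "N\<^sup>2 / 4 \<le> N\<^sup>2 / 8 + 2 * (B\<^sup>2 * M\<^sup>2) + (\<bar>l (v_h - u)\<bar> + \<bar>l (v - u_h)\<bar>)"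
    using h split unfolding dec by argo
  then have "N\<^sup>2 \<le> 16 * (B\<^sup>2 * M\<^sup>2) + 8 * (\<bar>l (v_h - u)\<bar> + \<bar>l (v - u_h)\<bar>)"
    by argo
  also have "8 * (\<bar>l (v_h - u)\<bar> + \<bar>l (v - u_h)\<bar>) \<le> (16 * B\<^sup>2) * (\<bar>l (v_h - u)\<bar> + \<bar>l (v - u_h)\<bar>)"
  proof (rule mult_right_mono)
    have "1 \<le> B\<^sup>2" using B by (simp add: one_le_power)
    then show "8 \<le> 16 * B\<^sup>2" by linarith
  qed simp
  finally have "N\<^sup>2 \<le> 16 * B\<^sup>2 * (M\<^sup>2 + \<bar>l (v_h - u)\<bar> + \<bar>l (v - u_h)\<bar>)"
    by (simp add: algebra_simps)
  then show ?thesis by (simp only: N_def M_def B_def p_def p_h_def q_h_def)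
qed

lemma le_mult_INF_add_INF:
  fixes F G :: "_ \<Rightarrow> real"
  assumes "A \<noteq> {}" "B \<noteq> {}" "0 < c"
    and le: "\<And>x y. x \<in> A \<Longrightarrow> y \<in> B \<Longrightarrow> N \<le> c * (F x + G y)"
  shows "N \<le> c * ((INF x\<in>A. F x) + (INF y\<in>B. G y))"
proof -
  have "N / c - F x \<le> (INF y\<in>B. G y)" if "x \<in> A" for x
  proof (rule cINF_greatest[OF assms(2)])
    show "N / c - F x \<le> G y" if "y \<in> B" for y
      using le[OF \<open>x \<in> A\<close> that] assms(3) by (simp add: field_simps)
  qed
  then have "N / c - (INF y\<in>B. G y) \<le> (INF x\<in>A. F x)"
    by (intro cINF_greatest[OF assms(1)]) (simp add: algebra_simps)
  then show ?thesis using assms(3) by (simp add: field_simps)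
qed

theorem theorem9:
  fixes \<Omega> :: "(real ^ 'n) set" and \<beta> C_F :: real
  assumes "CARD('n) \<in> {2, 3}"
    and "polyhedral_lipschitz_domain \<Omega>"
    and "friedrichs_constant \<Omega> C_F"
    and "\<beta> \<ge> 1 + C_F\<^sup>2"
  shows "\<exists>C_opt>0. \<forall>f g K_h u \<sigma> l u_h \<sigma>_h l_h.
     f \<in> L2 \<Omega> \<longrightarrow> g \<in> H1 \<Omega> \<longrightarrow> trace_nonpos \<Omega> g \<longrightarrow>
     solves_VI \<Omega> \<beta> f (K0 \<Omega> g) (u, \<sigma>, l) \<longrightarrow>
     K_h \<subseteq> U \<Omega> \<longrightarrow> K_h \<noteq> {} \<longrightarrow> convex K_h \<longrightarrow> U_closed \<Omega> K_h \<longrightarrow>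
     solves_VI \<Omega> \<beta> f K_h (u_h, \<sigma>_h, l_h) \<longrightarrow>
     (U_norm \<Omega> ((u, \<sigma>, l) - (u_h, \<sigma>_h, l_h)))\<^sup>2
       \<le> C_opt *
          ((INF (v_h, \<tau>_h, m_h)\<in>K_h.
              (U_norm \<Omega> ((u, \<sigma>, l) - (v_h, \<tau>_h, m_h)))\<^sup>2 + \<bar>l (v_h - u)\<bar>)
           + (INF (v, \<tau>, m)\<in>K0 \<Omega> g. \<bar>l (v - u_h)\<bar>))"
proof (intro exI[of _ "16 * (\<beta> + 5 + C_F)\<^sup>2"] conjI allI impI)
  have op: "open \<Omega>" using assms(2) by (simp add: polyhedral_lipschitz_domain_def)
  have "0 < C_F" using assms(3) by (simp add: friedrichs_constant_def)
  moreover have "0 \<le> C_F\<^sup>2" by simp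
  ultimately have "0 < \<beta> + 5 + C_F" using assms(4) by linarith
  then show pos: "0 < 16 * (\<beta> + 5 + C_F)\<^sup>2" by simp
  fix f g K_h u \<sigma> l u_h \<sigma>_h l_h
  assume f: "f \<in> L2 \<Omega>" and sol: "solves_VI \<Omega> \<beta> f (K0 \<Omega> g) (u, \<sigma>, l)"
    and sub: "K_h \<subseteq> U \<Omega>" and ne: "K_h \<noteq> {}"
    and sol_h: "solves_VI \<Omega> \<beta> f K_h (u_h, \<sigma>_h, l_h)"
  have "K0 \<Omega> g \<noteq> {}" using sol by (auto simp: solves_VI_def)
  then show "(U_norm \<Omega> ((u, \<sigma>, l) - (u_h, \<sigma>_h, l_h)))\<^sup>2
       \<le> 16 * (\<beta> + 5 + C_F)\<^sup>2 *
          ((INF (v_h, \<tau>_h, m_h)\<in>K_h.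
              (U_norm \<Omega> ((u, \<sigma>, l) - (v_h, \<tau>_h, m_h)))\<^sup>2 + \<bar>l (v_h - u)\<bar>)
           + (INF (v, \<tau>, m)\<in>K0 \<Omega> g. \<bar>l (v - u_h)\<bar>))"
  proof (rule le_mult_INF_add_INF[OF ne _ pos])
    fix x y assume "x \<in> K_h" "y \<in> K0 \<Omega> g"
    moreover obtain v_h \<tau>_h m_h where "x = (v_h, \<tau>_h, m_h)" by (cases x)
    moreover obtain v \<tau> m where "y = (v, \<tau>, m)" by (cases y)
    ultimately show "(U_norm \<Omega> ((u, \<sigma>, l) - (u_h, \<sigma>_h, l_h)))\<^sup>2
       \<le> 16 * (\<beta> + 5 + C_F)\<^sup>2 *
          ((case x of (v_h, \<tau>_h, m_h) \<Rightarrow>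
              (U_norm \<Omega> ((u, \<sigma>, l) - (v_h, \<tau>_h, m_h)))\<^sup>2 + \<bar>l (v_h - u)\<bar>)
           + (case y of (v, \<tau>, m) \<Rightarrow> \<bar>l (v - u_h)\<bar>))"
      using VI_error_bound[OF op assms(3,4) f sol sub sol_h] by (simp only: prod.case)
  qed
qed

end
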